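(* Let $\{z_j\}$ be a sequence of distinct points in $\mathcal{R}$ such that $\Re z_j\ge\varepsilon_0$ for some $\varepsilon_0>0$ and $$\limsup_{R\to+\infty}\frac1{\log R}\sum_{|z_j|\le R}\Re\big(1/z_j\big)>\frac2\pi .$$ Then $\{z_j\}$ is a set of uniqueness for $\mathcal{M}^2_\omega(\mathcal{R})$. As a consequence, if $\{z_j\}$ is such a sequence, the set of powers $\{\zeta^{z_j-1}\}$ is a complete set in $A^2(\Delta)$.
   Context: $\mathcal{R}=\{z\in\mathbf{C}:\Re z>0\}$, $\overline{\mathcal{R}}$ its closure. For $0<b<\infty$, $S_b=\{x+iy:0<x<b\}$ and $H^2(S_b)$ is the space of holomorphic $f$ on $S_b$ with $\sup_{0<x<b}\int_{-\infty}^{+\infty}|f(x+iy)|^2\,dy<\infty$; such functions have $L^2$ boundary values on the imaginary axis. Let $\omega=\sum_{n=0}^{+\infty}\frac{2^n}{n!}\,\delta_{n/2}(x)\otimes dy$ on $\overline{\mathcal{R}}$. $\mathcal{M}^2_\omega(\mathcal{R})$ is the space of holomorphic functions $f$ on $\mathcal{R}$ such that $f\in H^2(S_b)$ for every $0<b<\infty$ and $f\in L^2(\overline{\mathcal{R}},d\omega)$, i.e. $\sum_{n\ge0}\frac{2^n}{n!}\int_{-\infty}^{+\infty}|f(\frac n2+iy)|^2\,dy<\infty$ (boundary values used for $n=0$). A set $\{z_j\}\subseteq\mathcal{R}$ is a set of uniqueness for $\mathcal{M}^2_\omega(\mathcal{R})$ if $f\in\mathcal{M}^2_\omega(\mathcal{R})$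 and $f(z_j)=0$ for all $j$ imply $f\equiv0$. $\Delta=\{\zeta\in\mathbf{C}:|\zeta-1|<1\}$ and $A^2(\Delta)$ is the (unweighted) Bergman space of square-integrable holomorphic functions on $\Delta$. The powers $\zeta^{\lambda-1}$, $\Re\lambda>0$ (principal branch), belong to $A^2(\Delta)$. A set in $A^2(\Delta)$ is complete if its linear span is dense. *)

theory Defs
  imports "HOL-Analysis.Analysis" "HOL-Library.Function_Algebras"
begin

definition right_half_plane :: "complex set" where
  "right_half_plane = {z. 0 < Re z}"

definition strip :: "real \<Rightarrow> complex set" where
  "strip b = {z. 0 < Re z \<and> Re z < b}"

definition hardy2_strip :: "real \<Rightarrow> (complex \<Rightarrow> complex) set" where
  "hardy2_strip b = {f. f holomorphic_on strip b \<and>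
     (SUP x\<in>{0<..<b}. \<integral>\<^sup>+ y. ennreal ((cmod (f (Complex x y)))\<^sup>2) \<partial>lborel) < \<infinity>}"

text \<open>The sum of the measures \<open>2 ^ n / n! \<cdot> (\<delta>\<^bsub>n/2\<^esub> \<otimes> dy)\<close>, realised as the image
  of a weighted counting measure times Lebesgue measure; see
  \<open>nn_integral_omega_measure\<close> below.\<close>

definition omega_measure :: "complex measure" where
  "omega_measure =
     distr (density (count_space UNIV) (\<lambda>n::nat. ennreal (2 ^ n / fact n)) \<Otimes>\<^sub>M lborel)
       borel (\<lambda>(n, y). Complex (real n / 2) y)"

text \<open>Boundary values on the imaginary axis are taken in the \<open>L\<^sup>2\<close> sense, so \<open>g\<close> is
  determined by \<open>f\<close> up to a null set.\<close>

definition L2_boundary_values :: "(complex \<Rightarrow> complex) \<Rightarrow> (real \<Rightarrow> complex) \<Rightarrow> bool" where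
  "L2_boundary_values f g \<longleftrightarrow>
     g \<in> borel_measurable lborel \<and>
     (\<integral>\<^sup>+ y. ennreal ((cmod (g y))\<^sup>2) \<partial>lborel) < \<infinity> \<and>
     ((\<lambda>x. \<integral>\<^sup>+ y. ennreal ((cmod (f (Complex x y) - g y))\<^sup>2) \<partial>lborel) \<longlongrightarrow> 0) (at_right 0)"

definition extend_by_boundary ::
    "(complex \<Rightarrow> complex) \<Rightarrow> (real \<Rightarrow> complex) \<Rightarrow> complex \<Rightarrow> complex" where
  "extend_by_boundary f g z = (if 0 < Re z then f z else g (Im z))"

text \<open>Functions on the half plane are represented by total functions; their values outside
  \<^term>\<open>right_half_plane\<close> are irrelevant. The existence of the boundary function \<open>g\<close> is
  automatic for functions in the Hardy spaces of the strips; it is quantified only to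
  give a name to it.\<close>

definition M2_omega :: "(complex \<Rightarrow> complex) set" where
  "M2_omega = {f. f holomorphic_on right_half_plane \<and>
     (\<forall>b>0. f \<in> hardy2_strip b) \<and>
     (\<exists>g. L2_boundary_values f g \<and>
        extend_by_boundary f g \<in> borel_measurable omega_measure \<and>
        (\<integral>\<^sup>+ z. ennreal ((cmod (extend_by_boundary f g z))\<^sup>2) \<partial>omega_measure) < \<infinity>)}"

definition uniqueness_set_M2_omega :: "complex set \<Rightarrow> bool" where
  "uniqueness_set_M2_omega Z \<longleftrightarrow> Z \<subseteq> right_half_plane \<and>
     (\<forall>f\<in>M2_omega. (\<forall>w\<in>Z. f w = 0) \<longrightarrow> (\<forall>w\<in>right_half_plane. f w = 0))"

definition Delta :: "complex set" where
  "Delta = ball 1 1"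

definition bergman2 :: "(complex \<Rightarrow> complex) set" where
  "bergman2 = {f. f holomorphic_on Delta \<and>
     set_integrable lborel Delta (\<lambda>z. (cmod (f z))\<^sup>2)}"

definition bergman_norm :: "(complex \<Rightarrow> complex) \<Rightarrow> real" where
  "bergman_norm f = sqrt (set_lebesgue_integral lborel Delta (\<lambda>z. (cmod (f z))\<^sup>2))"

text \<open>The library's overloaded \<^const>\<open>span\<close> is the real span; completeness needs
  complex coefficients.\<close>

global_interpretation complex_fun:
  vector_space "\<lambda>(c::complex) (f :: complex \<Rightarrow> complex) z. c * f z"
  by unfold_locales (auto simp: fun_eq_iff algebra_simps)

definition complete_in_bergman2 :: "(complex \<Rightarrow> complex) set \<Rightarrow> bool" where
  "complete_in_bergman2 S \<longleftrightarrow> S \<subseteq> bergman2 \<and>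
     (\<forall>f\<in>bergman2. \<forall>e>0. \<exists>g\<in>complex_fun.span S. bergman_norm (\<lambda>z. f z - g z) < e)"

lemma nn_integral_omega_measure:
  fixes F :: "complex \<Rightarrow> ennreal"
  assumes [measurable]: "F \<in> borel_measurable borel"
  shows "(\<integral>\<^sup>+ z. F z \<partial>omega_measure) =
    (\<Sum>n. ennreal (2 ^ n / fact n) * (\<integral>\<^sup>+ y. F (Complex (real n / 2) y) \<partial>lborel))"
proof -
  let ?D = "density (count_space UNIV) (\<lambda>n::nat. ennreal (2 ^ n / fact n))"
  have [measurable]: "(\<lambda>(n, y). Complex (real n / 2) y) \<in> ?D \<Otimes>\<^sub>M lborel \<rightarrow>\<^sub>M borel"
  proof -
    have "(\<lambda>p. complex_of_real (real (fst p) / 2) + \<i> * complex_of_real (snd p))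
        \<in> ?D \<Otimes>\<^sub>M lborel \<rightarrow>\<^sub>M borel"
      by measurable
    moreover have "(\<lambda>p. complex_of_real (real (fst p) / 2) + \<i> * complex_of_real (snd p)) =
        (\<lambda>(n, y). Complex (real n / 2) y)"
      by (auto simp: fun_eq_iff complex_eq_iff)
    ultimately show ?thesis
      by (simp only:)
  qed
  have "(\<integral>\<^sup>+ z. F z \<partial>omega_measure) =
      (\<integral>\<^sup>+ p. F (case p of (n, y) \<Rightarrow> Complex (real n / 2) y) \<partial>(?D \<Otimes>\<^sub>M lborel))"
    unfolding omega_measure_def by (rule nn_integral_distr) auto
  also have "\<dots> = (\<integral>\<^sup>+ n. \<integral>\<^sup>+ y. F (Complex (real n / 2) y) \<partial>lborel \<partial>?D)"
    by (subst lborel.nn_integral_fst[symmetric]) auto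
  also have "\<dots> = (\<Sum>n. ennreal (2 ^ n / fact n) *
      (\<integral>\<^sup>+ y. F (Complex (real n / 2) y) \<partial>lborel))"
    by (simp add: nn_integral_density nn_integral_count_space_nat)
  finally show ?thesis .
qed

end

theory Submission
  imports Defs "HOL-Complex_Analysis.Complex_Analysis"
begin

text \<open>
  Both halves of the theorem are consequences of one uniqueness principle for holomorphic functions
  on the right half plane (\<open>vanishes_if_zeros_dense\<close>): if on each half plane
  \<open>x = \<Re>w \<ge> \<delta> > 0\<close> the function \<open>F\<close> satisfies
  \<open>log |F(w)| \<le> x log (1 + |w|) + O(1 + x)\<close>, and if it vanishes at points \<open>z\<^sub>j\<close> that
  satisfy the density condition, then it vanishes identically.

  The principle rests on a Carleman-type estimate (\<open>reciprocal_zero_sum_log_bound\<close>), which follows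
  from the maximum principle.
  Let \<open>A\<close> be a finite set of zeros in \<open>|w| \<le> t R\<close> with \<open>t\<close> small, divide \<open>F\<close> by the Blaschke
  product of the half plane with zeros \<open>A\<close>, and multiply by \<open>e\<^sup>-\<^sup>L\<^sup>w\<close>. On the imaginary
  axis the Blaschke product has modulus one. On the arc \<open>|w| = R\<close> its modulus differs from one by a
  factor of at most \<open>exp (O(t\<^sup>2) x S)\<close>, where \<open>S\<close> is the sum of \<open>\<Re>(1/a)\<close> over \<open>A\<close>, so with
  \<open>L = log R + O(t\<^sup>2) S + O(1)\<close> the resulting function is bounded on the whole boundary of the half
  disc, and hence inside. At a fixed small real point \<open>s\<close> the Blaschke product is about \<open>e\<^sup>-\<^sup>2\<^sup>s\<^sup>S\<close>, and
  comparing the two gives \<open>2 S \<le> log R + O(t\<^sup>2) S + O(1)\<close>. Hence the upper density of the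
  zeros is at most \<open>1/2\<close>, which is smaller than \<open>2/\<pi>\<close>.

  For \<open>f\<close> in the weighted Hardy space, the norms of \<open>f\<close> on the lines \<open>\<Re> w = n/2\<close> are at
  most a constant times \<open>sqrt (n! / 2\<^sup>n)\<close>; a maximum principle in the strips between these lines
  turns this into the growth condition (\<open>M2_omega_growth\<close>).

  Completeness of the powers in the Bergman space is the dual statement. If the distance \<open>d\<close> from
  \<open>f\<close> to the span of the powers were positive, then for a minimizing sequence the differences
  \<open>h\<^sub>n\<close> would be Cauchy in \<open>L\<^sup>2\<close> and asymptotically orthogonal to all the given powers.
  The transforms \<open>w \<mapsto> \<langle>\<zeta>\<^sup>w\<^sup>-\<^sup>1, h\<^sub>n\<rangle>\<close> converge to a holomorphic function that vanishes at
  all \<open>z\<^sub>j\<close> and is \<open>O(e\<^sup>\<pi>\<^sup>|\<^sup>y\<^sup>|\<^sup>/\<^sup>2 2\<^sup>x)\<close>. Multiplied by \<open>exp (w log (1 + w))\<close>, of modulus at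
  most \<open>exp (x log (1 + |w|) - \<pi> |y| / 2 + 1 + x)\<close>, it falls under the uniqueness principle, so it
  is zero. Taking \<open>w = 1, 2, 3, \<dots>\<close>, the \<open>h\<^sub>n\<close> are asymptotically orthogonal to all
  polynomials, and as these are dense in the Bergman space, \<open>d = 0\<close>.
\<close>

section \<open>Zeros of holomorphic functions on the right half plane\<close>

lemma holomorphic_divide_out_zeros:
  assumes "open U" "H holomorphic_on U" "finite A" "A \<subseteq> U" "\<And>a. a \<in> A \<Longrightarrow> H a = 0"
  shows "\<exists>G. G holomorphic_on U \<and> (\<forall>w\<in>U. H w = G w * (\<Prod>a\<in>A. w - a))"
  using assms(3,4,5)
proof (induction A rule: finite_induct)
  case empty
  then show ?case using assms(2) by (intro exI[of _ H]) auto
next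
  case (insert a A)
  then obtain G where G: "G holomorphic_on U" "\<And>w. w \<in> U \<Longrightarrow> H w = G w * (\<Prod>a\<in>A. w - a)"
    by auto
  have aU: "a \<in> U" using insert.prems by auto
  have "G a * (\<Prod>b\<in>A. a - b) = 0" using G(2)[OF aU] insert.prems by auto
  then have Ga: "G a = 0" using insert.hyps by auto
  define G' where "G' w = (if w = a then deriv G a else (G w - G a) / (w - a))" for w
  have "G' holomorphic_on U"
    unfolding G'_def using pole_lemma[OF G(1)] aU assms(1) by (simp add: interior_open)
  moreover have "H w = G' w * (\<Prod>a\<in>insert a A. w - a)" if "w \<in> U" for w
    using insert.hyps G(2)[OF that] Ga by (auto simp: G'_def)
  ultimately show ?case by blast
qed

text \<open>
  The quotient \<open>|w + cnj a| / |w - a|\<close> is the inverse modulus of the Blaschke factor of the half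
  plane with zero \<open>a\<close>. The identity shows that it is 1 on the imaginary axis and is the source of
  both the upper bound away from \<open>a\<close> and the lower bound at real points.
\<close>

lemma norm_add_cnj_power2:
  "(cmod (w + cnj a))\<^sup>2 = (cmod (w - a))\<^sup>2 + 4 * Re w * Re a"
  unfolding cmod_power2 by (simp add: algebra_simps power2_eq_square)

lemma norm_add_cnj_le:
  assumes "0 \<le> Re w" "0 < Re a" "0 < d" "d \<le> cmod (w - a)"
  shows "cmod (w + cnj a) \<le> cmod (w - a) * exp (2 * Re w * Re a / d\<^sup>2)"
proof (rule power2_le_imp_le)
  let ?n = "cmod (w - a)"
  have n: "0 < ?n" using assms by linarith
  have d2: "d\<^sup>2 \<le> ?n\<^sup>2" "0 < d\<^sup>2" using assms by (auto intro: power_mono)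
  have "(cmod (w + cnj a))\<^sup>2 = ?n\<^sup>2 * (1 + 4 * Re w * Re a / ?n\<^sup>2)"
    using n by (simp add: norm_add_cnj_power2 field_simps)
  also have "\<dots> \<le> ?n\<^sup>2 * exp (4 * Re w * Re a / d\<^sup>2)"
  proof (intro mult_left_mono)
    have "4 * Re w * Re a / ?n\<^sup>2 \<le> 4 * Re w * Re a / d\<^sup>2"
      using d2 assms n by (intro divide_left_mono) auto
    then show "1 + 4 * Re w * Re a / ?n\<^sup>2 \<le> exp (4 * Re w * Re a / d\<^sup>2)"
      using exp_ge_add_one_self[of "4 * Re w * Re a / d\<^sup>2"] by linarith
  qed auto
  also have "\<dots> = (?n * exp (2 * Re w * Re a / d\<^sup>2))\<^sup>2"
    by (simp add: power_mult_distrib flip: exp_double)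
  finally show "(cmod (w + cnj a))\<^sup>2 \<le> (?n * exp (2 * Re w * Re a / d\<^sup>2))\<^sup>2" .
qed auto

lemma exp_double_le_one_plus_over_one_minus:
  fixes q :: real
  assumes "0 \<le> q" "q < 1"
  shows "exp (2 * q) * (1 - q) \<le> 1 + q"
proof -
  let ?f = "\<lambda>q::real. ln (1 + q) - ln (1 - q) - 2 * q"
  have "?f 0 \<le> ?f q"
  proof (rule DERIV_nonneg_imp_nondecreasing[OF assms(1)])
    fix x assume x: "0 \<le> x" "x \<le> q"
    have "(?f has_real_derivative (1 / (1 + x) + 1 / (1 - x) - 2)) (at x)"
      using x assms by (auto intro!: derivative_eq_intros simp: divide_simps)
    moreover have "1 / (1 + x) + 1 / (1 - x) - 2 = 2 * x\<^sup>2 / ((1 + x) * (1 - x))"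
      using x assms by (simp add: divide_simps) (simp add: algebra_simps power2_eq_square)
    moreover have "2 * x\<^sup>2 / ((1 + x) * (1 - x)) \<ge> 0"
      using x assms by (intro divide_nonneg_nonneg mult_nonneg_nonneg) auto
    ultimately show "\<exists>y. (?f has_real_derivative y) (at x) \<and> 0 \<le> y" by auto
  qed
  then have "exp (2 * q) * exp (ln (1 - q)) \<le> exp (ln (1 + q))"
    unfolding exp_add[symmetric] by simp
  then show ?thesis using assms by simp
qed

text \<open>
  With \<open>q = 2 s \<Re>a / (|a|\<^sup>2 + s\<^sup>2)\<close> the squared quotient at the real point \<open>s\<close> is
  exactly \<open>(1 + q) / (1 - q)\<close>, whose logarithm is at least \<open>2 q\<close>. The bound is stated without
  division, so that it also covers the case \<open>a = s\<close>.
\<close>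

lemma norm_add_cnj_ge:
  fixes s :: real and a :: complex
  assumes "0 < s" "0 < Re a"
  shows "cmod (s - a) * exp (2 * s * Re a / ((cmod a)\<^sup>2 + s\<^sup>2)) \<le> cmod (s + cnj a)"
proof (rule power2_le_imp_le)
  define N where "N = (cmod a)\<^sup>2 + s\<^sup>2"
  define q where "q = 2 * s * Re a / N"
  have N: "N > 0" using assms by (simp add: N_def add_nonneg_pos)
  have Nq: "N * q = 2 * s * Re a" using N by (simp add: q_def)
  have m: "(cmod (s - a))\<^sup>2 = N * (1 - q)" and p: "(cmod (s + cnj a))\<^sup>2 = N * (1 + q)"
    unfolding right_diff_distrib distrib_left Nq
    unfolding N_def cmod_power2 by (simp_all add: power2_eq_square algebra_simps)
  have q0: "0 \<le> q" using assms N by (simp add: q_def)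
  show "(cmod (s - a) * exp (2 * s * Re a / ((cmod a)\<^sup>2 + s\<^sup>2)))\<^sup>2 \<le> (cmod (s + cnj a))\<^sup>2"
  proof (cases "q < 1")
    case True
    have "(cmod (s - a) * exp q)\<^sup>2 = N * (exp (2 * q) * (1 - q))"
      by (simp add: power_mult_distrib m flip: exp_double)
    also have "\<dots> \<le> N * (1 + q)"
      using exp_double_le_one_plus_over_one_minus[OF q0 True] N by (intro mult_left_mono) auto
    finally show ?thesis unfolding p unfolding q_def N_def .
  next
    case False
    then have "N * (1 - q) \<le> 0" using N by (simp add: mult_nonneg_nonpos)
    then have "(cmod (s - a))\<^sup>2 = 0" using m by (smt (verit) zero_le_power2)
    then show ?thesis by simp
  qed
qed auto

text \<open>
  The maximum principle on the half disc of radius \<open>R\<close>, applied to \<open>H\<close> divided by its Blaschke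
  product and damped by an exponential. The zeros have to stay in the smaller disc of radius
  \<open>t R\<close>: this keeps the Blaschke factors close to modulus one on the arc, and it makes the resulting
  error \<open>O(t\<^sup>2)\<close> times the sum that is being estimated, so that it can be absorbed.
\<close>

lemma zeros_bound_half_disc:
  fixes H :: "complex \<Rightarrow> complex" and C R s t :: real
  assumes U: "open U" "{w. 0 \<le> Re w} \<subseteq> U" and holH: "H holomorphic_on U"
    and bound: "\<And>w. 0 \<le> Re w \<Longrightarrow> cmod (H w) \<le> exp (C * (1 + Re w) + Re w * ln (1 + cmod w))"
    and A: "finite A" "\<And>a. a \<in> A \<Longrightarrow> H a = 0" "\<And>a. a \<in> A \<Longrightarrow> 0 < Re a"
      "\<And>a. a \<in> A \<Longrightarrow> cmod a \<le> t * R"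
    and t: "0 < t" "t < 1" and s: "0 < s" "s < R" "H s \<noteq> 0"
  shows "ln (cmod (H s)) + (\<Sum>a\<in>A. 2 * s * Re a / ((cmod a)\<^sup>2 + s\<^sup>2))
    \<le> C + s * (C + ln (1 + R) + 2 * t\<^sup>2 / (1 - t)\<^sup>2 * (\<Sum>a\<in>A. Re (1 / a)))"
proof -
  have R: "0 < R" using s by simp
  have AU: "A \<subseteq> U" using A(3) U(2) by (force intro: less_imp_le)
  obtain G where G: "G holomorphic_on U" "\<And>w. w \<in> U \<Longrightarrow> H w = G w * (\<Prod>a\<in>A. w - a)"
    using holomorphic_divide_out_zeros[OF U(1) holH A(1) AU A(2)] by blast
  define d where "d = (1 - t) * R"
  have d: "0 < d" using t R by (simp add: d_def)
  \<comment> \<open>\<open>L\<close> is the smallest rate for which the exponential compensates both the growth of \<open>H\<close> and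
    the Blaschke factors on the arc.\<close>
  define L where "L = C + ln (1 + R) + 2 / d\<^sup>2 * (\<Sum>a\<in>A. Re a)"
  define P where "P w = G w * (\<Prod>a\<in>A. w + cnj a) * exp (- (of_real L * w))" for w
  define S where "S = {w. 0 \<le> Re w} \<inter> cball 0 R"
  have clS: "closed S" unfolding S_def by (intro closed_Int closed_halfspace_Re_ge) auto
  have intS: "{w. 0 < Re w} \<inter> ball 0 R \<subseteq> interior S"
    by (intro interior_maximal) (auto simp: S_def intro: open_halfspace_Re_gt)
  have SU: "S \<subseteq> U" using U(2) by (auto simp: S_def)
  have holP: "P holomorphic_on U"
    unfolding P_def by (intro holomorphic_intros G)
  have "cmod (P s) \<le> exp C"
  proof (rule maximum_modulus_frontier[of P S])
    show "P holomorphic_on interior S"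
      using holP SU interior_subset holomorphic_on_subset by blast
    show "continuous_on (closure S) P"
      using holP SU clS by (simp add: holomorphic_on_imp_continuous_on holomorphic_on_subset)
    show "bounded S" by (simp add: S_def bounded_Int)
    show "complex_of_real s \<in> S" using s by (auto simp: S_def)
    fix w assume "w \<in> frontier S"
    then have w: "w \<in> S" "\<not> (0 < Re w \<and> cmod w < R)"
      using clS intS by (auto simp: frontier_def)
    then have wU: "w \<in> U" using SU by auto
    have x: "0 \<le> Re w" "cmod w \<le> R" using w by (auto simp: S_def)
    have fac: "cmod (w + cnj a) \<le> cmod (w - a) * exp (2 * Re w * Re a / d\<^sup>2)" if "a \<in> A" for a
    proof (cases "Re w = 0")
      case True
      have "(cmod (w + cnj a))\<^sup>2 = (cmod (w - a))\<^sup>2" by (simp add: norm_add_cnj_power2 True)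
      then show ?thesis using True by (simp add: power2_eq_iff_nonneg)
    next
      case False
      then have "cmod w = R" using w x by auto
      moreover have "cmod w \<le> cmod (w - a) + cmod a" 
        using norm_triangle_sub[of w a] by simp
      ultimately have "d \<le> cmod (w - a)"
        using A(4)[OF that] by (simp add: d_def algebra_simps)
      then show ?thesis using norm_add_cnj_le x A(3) that d by blast
    qed
    have "cmod (P w) = cmod (G w) * (\<Prod>a\<in>A. cmod (w + cnj a)) * exp (- (L * Re w))"
      by (simp add: P_def norm_mult prod_norm)
    also have "\<dots> \<le> cmod (G w) * (\<Prod>a\<in>A. cmod (w - a) * exp (2 * Re w * Re a / d\<^sup>2)) * exp (- (L * Re w))"
      using fac by (intro mult_right_mono mult_left_mono prod_mono) auto
    also have "\<dots> = cmod (H w) * exp ((\<Sum>a\<in>A. 2 * Re w * Re a / d\<^sup>2)) * exp (- (L * Re w))"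
      by (simp add: G(2)[OF wU] norm_mult prod_norm prod.distrib exp_sum[OF A(1)])
    also have "\<dots> \<le> exp (C * (1 + Re w) + Re w * ln (1 + R)) * exp ((\<Sum>a\<in>A. 2 * Re w * Re a / d\<^sup>2)) * exp (- (L * Re w))"
    proof (intro mult_right_mono)
      have "cmod (H w) \<le> exp (C * (1 + Re w) + Re w * ln (1 + cmod w))" by (rule bound[OF x(1)])
      also have "Re w * ln (1 + cmod w) \<le> Re w * ln (1 + R)"
        using x norm_ge_zero[of w] by (intro mult_left_mono, subst ln_le_cancel_iff) linarith+
      finally show "cmod (H w) \<le> exp (C * (1 + Re w) + Re w * ln (1 + R))" by simp
    qed auto
    also have "\<dots> = exp (C * (1 + Re w) + Re w * ln (1 + R) + (\<Sum>a\<in>A. 2 * Re w * Re a / d\<^sup>2) - L * Re w)"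
      by (simp add: exp_diff exp_add exp_minus field_simps)
    also have "(\<Sum>a\<in>A. 2 * Re w * Re a / d\<^sup>2) = Re w * (2 / d\<^sup>2 * (\<Sum>a\<in>A. Re a))"
      by (simp add: sum_distrib_left sum_distrib_right sum_divide_distrib mult_ac)
    also have "C * (1 + Re w) + Re w * ln (1 + R) + Re w * (2 / d\<^sup>2 * (\<Sum>a\<in>A. Re a)) - L * Re w = C"
      by (simp add: L_def algebra_simps)
    finally show "cmod (P w) \<le> exp C" .
  qed
  have sU: "complex_of_real s \<in> U" using s U(2) by auto
  define T where "T = (\<Sum>a\<in>A. 2 * s * Re a / ((cmod a)\<^sup>2 + s\<^sup>2))"
  have "cmod (H s) * exp T * exp (- (L * s))
      = cmod (G s) * (\<Prod>a\<in>A. cmod (s - a) * exp (2 * s * Re a / ((cmod a)\<^sup>2 + s\<^sup>2))) * exp (- (L * s))"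
    by (simp add: G(2)[OF sU] norm_mult prod_norm prod.distrib exp_sum[OF A(1)] T_def)
  also have "\<dots> \<le> cmod (G s) * (\<Prod>a\<in>A. cmod (s + cnj a)) * exp (- (L * s))"
    using norm_add_cnj_ge s A(3) by (intro mult_right_mono mult_left_mono prod_mono) auto
  also have "\<dots> = cmod (P s)" by (simp add: P_def norm_mult prod_norm)
  finally have "cmod (H s) * exp T * exp (- (L * s)) \<le> exp C" using \<open>cmod (P s) \<le> exp C\<close> by simp
  moreover have "cmod (H s) = exp (ln (cmod (H s)))" using s by simp
  ultimately have "exp (ln (cmod (H s)) + T - L * s) \<le> exp C"
    by (simp add: exp_add exp_diff exp_minus field_simps)
  then have 1: "ln (cmod (H s)) + T \<le> C + s * L" by (simp add: mult.commute)
  \<comment> \<open>As \<open>|a| \<le> t R\<close>, each \<open>\<Re>a = |a|\<^sup>2 \<Re>(1/a)\<close> is controlled by \<open>\<Re>(1/a)\<close>.\<close>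
  have "(\<Sum>a\<in>A. Re a) \<le> (\<Sum>a\<in>A. t\<^sup>2 * R\<^sup>2 * Re (1 / a))"
  proof (rule sum_mono)
    fix a assume a: "a \<in> A"
    then have "a \<noteq> 0" using A(3) by force
    then have n: "0 < (cmod a)\<^sup>2" by simp
    have "Re a = (cmod a)\<^sup>2 * Re (1 / a)"
      using n by (simp add: Re_divide cmod_power2)
    also have "\<dots> \<le> (t * R)\<^sup>2 * Re (1 / a)"
      using A(3,4)[OF a] by (intro mult_right_mono power_mono) (auto simp: Re_divide less_imp_le)
    finally show "Re a \<le> t\<^sup>2 * R\<^sup>2 * Re (1 / a)" by (simp add: power_mult_distrib)
  qed
  then have "2 / d\<^sup>2 * (\<Sum>a\<in>A. Re a) \<le> 2 / d\<^sup>2 * (t\<^sup>2 * R\<^sup>2 * (\<Sum>a\<in>A. Re (1 / a)))"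
    using d by (intro mult_left_mono) (auto simp: sum_distrib_left)
  also have "\<dots> = 2 * t\<^sup>2 / (1 - t)\<^sup>2 * (\<Sum>a\<in>A. Re (1 / a))"
    using R t by (simp add: d_def power_mult_distrib)
  finally have "L \<le> C + ln (1 + R) + 2 * t\<^sup>2 / (1 - t)\<^sup>2 * (\<Sum>a\<in>A. Re (1 / a))"
    by (simp add: L_def)
  then show ?thesis using 1 s(1) unfolding T_def by (smt (verit) mult_left_mono)
qed


lemma Re_inverse_ge_of_shift:
  fixes a :: complex
  assumes "0 < \<epsilon>" "\<epsilon> \<le> Re a" "0 \<le> \<theta>" "\<theta> < 1"
  shows "(1 - \<theta>) * Re (1 / a) \<le> Re (1 / (a - of_real (\<theta> * \<epsilon>)))"
proof -
  define b where "b = a - of_real (\<theta> * \<epsilon>)"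
  have te: "\<theta> * \<epsilon> \<le> \<theta> * Re a" "\<theta> * Re a < Re a" "0 \<le> \<theta> * \<epsilon>"
    using assms mult_left_mono[of \<epsilon> "Re a" \<theta>] mult_strict_right_mono[of \<theta> 1 "Re a"] by auto
  have b: "(1 - \<theta>) * Re a \<le> Re b" "0 < Re b" "Re b \<le> Re a" "Im b = Im a"
    using te by (auto simp: b_def algebra_simps)
  then have nb: "(cmod b)\<^sup>2 \<le> (cmod a)\<^sup>2" "0 < (cmod b)\<^sup>2"
    unfolding cmod_power2 by (auto intro!: power_mono add_pos_nonneg)
  have "(1 - \<theta>) * Re (1 / a) = (1 - \<theta>) * Re a / (cmod a)\<^sup>2"
    by (simp add: Re_divide cmod_power2)
  also have "\<dots> \<le> Re b / (cmod b)\<^sup>2"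
    using nb b assms by (intro frac_le) auto
  also have "\<dots> = Re (1 / b)" by (simp add: Re_divide cmod_power2)
  finally show ?thesis unfolding b_def .
qed

text \<open>
  The preceding lemma needs a function that is holomorphic across the imaginary axis. Therefore \<open>F\<close>
  is translated by \<open>\<delta> = \<theta> \<epsilon>\<close>, which costs a factor \<open>1 - \<theta>\<close> in the sum over the zeros. The
  translated growth bound is no longer bounded on the imaginary axis but of size \<open>|w|\<^sup>\<delta>\<close> there;
  the factor \<open>(1 + w)\<^sup>-\<^sup>\<delta>\<close> removes this. Each of the three losses (\<open>\<theta>\<close>, \<open>t\<close> and the
  position \<open>s\<close> of the comparison point) can be made small, which leaves any constant
  \<open>c > 1/2\<close>.
\<close>

theorem reciprocal_zero_sum_log_bound:
  assumes holF: "F holomorphic_on right_half_plane"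
    and growth: "\<And>\<delta>. 0 < \<delta> \<Longrightarrow> \<exists>C. \<forall>w. \<delta> \<le> Re w \<longrightarrow>
      cmod (F w) \<le> exp (C * (1 + Re w) + Re w * ln (1 + cmod w))"
    and nz: "w0 \<in> right_half_plane" "F w0 \<noteq> 0"
    and e: "0 < \<epsilon>" and c: "1 / 2 < (c::real)"
  shows "\<exists>K. \<forall>A r. finite A \<and> 1 \<le> r \<and> (\<forall>a\<in>A. F a = 0 \<and> \<epsilon> \<le> Re a \<and> cmod a \<le> r)
    \<longrightarrow> (\<Sum>a\<in>A. Re (1 / a)) \<le> c * ln r + K"
proof -
  define c' where "c' = (c + 1 / 2) / 2"
  have c': "1 / 2 < c'" "c' < c" using c by (auto simp: c'_def)
  define \<theta> where "\<theta> = 1 - c' / c"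
  have \<theta>: "0 < \<theta>" "\<theta> < 1" "c' = c * (1 - \<theta>)" using c c' by (auto simp: \<theta>_def)
  define \<delta> where "\<delta> = \<theta> * \<epsilon>"
  define \<epsilon>' where "\<epsilon>' = (1 - \<theta>) * \<epsilon>"
  have \<delta>: "0 < \<delta>" "0 < \<epsilon>'" "\<epsilon> = \<delta> + \<epsilon>'" using \<theta> e by (auto simp: \<delta>_def \<epsilon>'_def algebra_simps)
  obtain C0 where C0: "\<And>w. \<delta> \<le> Re w \<Longrightarrow> cmod (F w) \<le> exp (C0 * (1 + Re w) + Re w * ln (1 + cmod w))"
    using growth[OF \<delta>(1)] by blast
  define H where "H w = F (w + of_real \<delta>) * exp (- (of_real \<delta> * Ln (1 + (w + of_real \<delta>))))" for w
  define U where "U = {w::complex. - \<delta> < Re w}"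
  have U: "open U" "{w. 0 \<le> Re w} \<subseteq> U"
    using \<delta> by (auto simp: U_def open_halfspace_Re_gt)
  have holH: "H holomorphic_on U"
  proof -
    have "(\<lambda>w. F (w + of_real \<delta>)) holomorphic_on U"
      by (rule holomorphic_on_compose_gen[OF _ holF, unfolded o_def])
        (auto intro!: holomorphic_intros simp: U_def right_half_plane_def)
    then show ?thesis unfolding H_def
      by (intro holomorphic_intros) (auto simp: U_def complex_nonpos_Reals_iff)
  qed
  define C where "C = \<bar>C0\<bar> * (1 + \<delta>) + ln (1 + \<delta>) + \<delta> * ln 2"
  have Cp: "0 \<le> C" using \<delta> by (simp add: C_def)
  have bound: "cmod (H w) \<le> exp (C * (1 + Re w) + Re w * ln (1 + cmod w))" if w: "0 \<le> Re w" for w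
  proof -
    define v where "v = w + of_real \<delta>"
    have Rv: "Re v = Re w + \<delta>" by (simp add: v_def)
    have v1: "1 \<le> cmod (1 + v)" "cmod v \<le> cmod (1 + v)"
    proof -
      show "1 \<le> cmod (1 + v)" using complex_Re_le_cmod[of "1 + v"] w Rv \<delta> by simp
      have "(cmod v)\<^sup>2 \<le> (cmod (1 + v))\<^sup>2"
        unfolding cmod_power2 using w Rv \<delta> by (auto intro!: power_mono)
      then show "cmod v \<le> cmod (1 + v)" by (rule power2_le_imp_le) simp
    qed
    have "ln (1 + cmod v) \<le> ln (2 * cmod (1 + v))"
      using v1 by (subst ln_le_cancel_iff) (auto intro: add_pos_nonneg)
    also have "\<dots> = ln 2 + ln (cmod (1 + v))" using v1 by (subst ln_mult) auto
    finally have l1: "ln (1 + cmod v) \<le> ln 2 + ln (cmod (1 + v))" .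
    have "1 + cmod v \<le> (1 + \<delta>) * (1 + cmod w)"
      using norm_triangle_ineq[of w "of_real \<delta>"] \<delta> by (simp add: v_def algebra_simps)
        (smt (verit) mult_nonneg_nonneg norm_ge_zero)
    then have "ln (1 + cmod v) \<le> ln ((1 + \<delta>) * (1 + cmod w))"
      using \<delta> by (subst ln_le_cancel_iff) (auto intro!: add_pos_nonneg mult_pos_pos)
    also have "\<dots> = ln (1 + \<delta>) + ln (1 + cmod w)"
      using \<delta> norm_ge_zero[of w] by (subst ln_mult) (auto simp del: norm_ge_zero)
    finally have l2: "ln (1 + cmod v) \<le> ln (1 + \<delta>) + ln (1 + cmod w)" .
    have "cmod (H w) = cmod (F v) * exp (- (\<delta> * ln (cmod (1 + v))))"
    proof -
      have "1 + v \<noteq> 0" using v1 by auto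
      then show ?thesis by (simp add: H_def norm_mult norm_exp_eq_Re flip: v_def)
    qed
    also have "\<dots> \<le> exp (C0 * (1 + Re v) + Re v * ln (1 + cmod v)) * exp (- (\<delta> * ln (cmod (1 + v))))"
      using C0[of v] w Rv by (intro mult_right_mono) auto
    also have "\<dots> = exp (C0 * (1 + Re v) + Re v * ln (1 + cmod v) - \<delta> * ln (cmod (1 + v)))"
      by (simp add: exp_add exp_diff exp_minus field_simps)
    also have "\<dots> \<le> exp (C * (1 + Re w) + Re w * ln (1 + cmod w))"
    proof (subst exp_le_cancel_iff)
      have "C0 * (1 + Re v) \<le> \<bar>C0\<bar> * ((1 + \<delta>) * (1 + Re w))"
        using w Rv \<delta> by (intro mult_mono) (auto simp: algebra_simps)
      moreover have "\<delta> * ln (1 + cmod v) \<le> \<delta> * (ln 2 + ln (cmod (1 + v)))"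
        using l1 \<delta> by (intro mult_left_mono) auto
      moreover have "Re w * ln (1 + cmod v) \<le> Re w * (ln (1 + \<delta>) + ln (1 + cmod w))"
        using l2 w by (intro mult_left_mono) auto
      moreover have "\<delta> * ln 2 * Re w \<ge> 0" "ln (1 + \<delta>) \<ge> 0" using \<delta> w by auto
      ultimately show "C0 * (1 + Re v) + Re v * ln (1 + cmod v) - \<delta> * ln (cmod (1 + v))
          \<le> C * (1 + Re w) + Re w * ln (1 + cmod w)"
        by (simp add: Rv C_def algebra_simps)
    qed
    finally show ?thesis .
  qed
  have "((\<lambda>t::real. 2 / (1 + t\<^sup>2) - 2 * t\<^sup>2 / (1 - t)\<^sup>2) \<longlongrightarrow> 2 / (1 + 0\<^sup>2) - 2 * 0\<^sup>2 / (1 - 0)\<^sup>2) (at_right 0)"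
    by (intro tendsto_intros) auto
  moreover have "1 / c' < 2 / (1 + 0\<^sup>2) - 2 * 0\<^sup>2 / (1 - 0)\<^sup>2" using c' by (simp add: field_simps)
  ultimately have "eventually (\<lambda>t::real. 1 / c' < 2 / (1 + t\<^sup>2) - 2 * t\<^sup>2 / (1 - t)\<^sup>2) (at_right 0)"
    by (rule order_tendstoD)
  moreover have "eventually (\<lambda>t::real. t \<in> {0<..<1}) (at_right 0)"
    by (rule eventually_at_right_real) simp
  ultimately have "eventually (\<lambda>t::real. 1 / c' < 2 / (1 + t\<^sup>2) - 2 * t\<^sup>2 / (1 - t)\<^sup>2 \<and> t \<in> {0<..<1}) (at_right 0)"
    by (rule eventually_conj)
  from eventually_happens'[OF _ this] obtain t :: real
    where t: "0 < t" "t < 1" "1 / c' < 2 / (1 + t\<^sup>2) - 2 * t\<^sup>2 / (1 - t)\<^sup>2"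
    by auto
  define D where "D = 2 / (1 + t\<^sup>2) - 2 * t\<^sup>2 / (1 - t)\<^sup>2"
  have D: "0 < D" "1 / D \<le> c'"
  proof -
    have "0 < 1 / c'" "1 / c' < D" using t(3) c' by (auto simp: D_def)
    then show "0 < D" by linarith
    then show "1 / D \<le> c'" using \<open>1 / c' < D\<close> c' by (simp add: field_simps)
  qed
  define \<sigma> where "\<sigma> = min (t * \<epsilon>') 1"
  have \<sigma>: "0 < \<sigma>" "\<sigma> \<le> t * \<epsilon>'" "\<sigma> \<le> 1" using t \<delta> by (auto simp: \<sigma>_def)
  \<comment> \<open>Were there no admissible comparison point, \<open>H\<close> would vanish on a real interval.\<close>
  have "\<exists>s. 0 < s \<and> s < \<sigma> \<and> H (complex_of_real s) \<noteq> 0"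
  proof (rule ccontr)
    assume "\<not> ?thesis"
    then have Hz: "H (complex_of_real s) = 0" if "0 < s" "s < \<sigma>" for s using that by blast
    have "H w = 0" if "w \<in> U" for w
    proof (rule analytic_continuation[OF holH U(1), of "of_real ` {0<..<\<sigma>}" "of_real (\<sigma> / 2)"])
      show "connected U" unfolding U_def by (intro convex_connected convex_halfspace_Re_gt)
      show "complex_of_real ` {0<..<\<sigma>} \<subseteq> U" using U(2) by auto
      show "complex_of_real (\<sigma> / 2) \<in> U" using U(2) \<sigma> by auto
      have "(\<sigma> / 2) islimpt {0<..<\<sigma>}" using \<sigma> by (intro open_imp_islimpt) auto
      then show "complex_of_real (\<sigma> / 2) islimpt complex_of_real ` {0<..<\<sigma>}"
        unfolding islimpt_approachable by (metis dist_of_real imageI of_real_eq_iff)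
    qed (use Hz that in auto)
    then have "H (w0 - of_real \<delta>) = 0" using nz(1) by (auto simp: U_def right_half_plane_def)
    then show False using nz(2) by (simp add: H_def)
  qed
  then obtain s where s: "0 < s" "s < \<sigma>" "H (complex_of_real s) \<noteq> 0" by blast
  define K where "K = \<bar>C - ln (cmod (H s))\<bar> / s + C + ln (1 + 1 / t)"
  show ?thesis
  proof (intro exI[of _ "c * K"] allI impI, elim conjE)
    fix A :: "complex set" and r :: real
    assume A: "finite A" "1 \<le> r" "\<forall>a\<in>A. F a = 0 \<and> \<epsilon> \<le> Re a \<and> cmod a \<le> r"
    define B where "B = (\<lambda>a. a - of_real \<delta>) ` A"
    have B: "\<epsilon>' \<le> Re b" "H b = 0" "cmod b \<le> t * (r / t)" if bB: "b \<in> B" for b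
    proof -
      obtain a where a: "a \<in> A" "b = a - of_real \<delta>" using bB unfolding B_def by blast
      show "\<epsilon>' \<le> Re b" "H b = 0" using a A(3) \<delta> by (auto simp: H_def)
      have "(cmod b)\<^sup>2 \<le> (cmod a)\<^sup>2"
        unfolding cmod_power2 using a A(3) \<delta> by (auto intro!: power_mono)
      then have "cmod b \<le> cmod a" by (rule power2_le_imp_le) simp
      then show "cmod b \<le> t * (r / t)" using a A(3) t by fastforce
    qed
    define S where "S = (\<Sum>b\<in>B. Re (1 / b))"
    have "r / t > 1" using A(2) t by (simp add: less_divide_eq)
    then have sR: "s < r / t" using s \<sigma> by simp
    have "ln (cmod (H s)) + (\<Sum>a\<in>B. 2 * s * Re a / ((cmod a)\<^sup>2 + s\<^sup>2))
      \<le> C + s * (C + ln (1 + r / t) + 2 * t\<^sup>2 / (1 - t)\<^sup>2 * S)"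
      unfolding S_def using A(1) \<delta>(2) B sR
      by (intro zeros_bound_half_disc[OF U holH bound] t s) (fastforce simp: B_def)+
    moreover have "(\<Sum>a\<in>B. 2 * s * Re a / ((cmod a)\<^sup>2 + s\<^sup>2)) \<ge> (\<Sum>b\<in>B. s * (2 / (1 + t\<^sup>2)) * Re (1 / b))"
    proof (rule sum_mono)
      fix b assume b: "b \<in> B"
      have "0 < Re b" "\<epsilon>' \<le> cmod b" using B(1)[OF b] \<delta> complex_Re_le_cmod[of b] by auto
      then have "s \<le> t * cmod b" using s \<sigma> t mult_left_mono[of \<epsilon>' "cmod b" t] by linarith
      then have "s\<^sup>2 \<le> (t * cmod b)\<^sup>2" using s by (intro power_mono) auto
      then have "(cmod b)\<^sup>2 + s\<^sup>2 \<le> (1 + t\<^sup>2) * (cmod b)\<^sup>2" by (simp add: power_mult_distrib algebra_simps)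
      then have "2 * s * Re b / ((1 + t\<^sup>2) * (cmod b)\<^sup>2) \<le> 2 * s * Re b / ((cmod b)\<^sup>2 + s\<^sup>2)"
        using s \<open>0 < Re b\<close> by (intro divide_left_mono mult_pos_pos add_nonneg_pos) (auto simp: add_pos_nonneg)
      then show "s * (2 / (1 + t\<^sup>2)) * Re (1 / b) \<le> 2 * s * Re b / ((cmod b)\<^sup>2 + s\<^sup>2)"
        by (simp add: Re_divide mult.commute[of s] flip: cmod_power2)
    qed
    moreover have "(\<Sum>b\<in>B. s * (2 / (1 + t\<^sup>2)) * Re (1 / b)) = s * (2 / (1 + t\<^sup>2)) * S"
      by (simp add: S_def sum_distrib_left)
    ultimately have "s * (2 / (1 + t\<^sup>2)) * S \<le> C - ln (cmod (H s)) + s * (C + ln (1 + r / t) + 2 * t\<^sup>2 / (1 - t)\<^sup>2 * S)"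
      by linarith
    then have "s * (D * S) \<le> C - ln (cmod (H s)) + s * (C + ln (1 + r / t))"
      by (simp add: D_def algebra_simps)
    also have "\<dots> \<le> \<bar>C - ln (cmod (H s))\<bar> + s * (C + ln (1 + r / t))" by simp
    also have "\<dots> = s * (\<bar>C - ln (cmod (H s))\<bar> / s + C + ln (1 + r / t))"
      using s by (simp add: algebra_simps)
    also have "\<dots> \<le> s * (K + ln r)"
    proof (intro mult_left_mono)
      have "ln (1 + r / t) \<le> ln (r * (1 + 1 / t))"
        using A(2) t by (subst ln_le_cancel_iff) (auto simp: algebra_simps add_pos_pos)
      also have "\<dots> = ln r + ln (1 + 1 / t)" using A(2) t add_pos_pos[of 1 "1 / t"] by (subst ln_mult) auto
      finally show "\<bar>C - ln (cmod (H s))\<bar> / s + C + ln (1 + r / t) \<le> K + ln r" by (simp add: K_def)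
    qed (use s in auto)
    finally have DS: "D * S \<le> K + ln r" using s by simp
    have K0: "0 \<le> K" using s t Cp by (simp add: K_def)
    have "S \<le> 1 / D * (K + ln r)" using DS D by (simp add: field_simps)
    also have "\<dots> \<le> c' * (K + ln r)" using D K0 A(2) by (intro mult_right_mono) auto
    finally have S: "S \<le> c' * (K + ln r)" .
    have "(1 - \<theta>) * (\<Sum>a\<in>A. Re (1 / a)) = (\<Sum>a\<in>A. (1 - \<theta>) * Re (1 / a))" by (rule sum_distrib_left)
    also have "\<dots> \<le> (\<Sum>a\<in>A. Re (1 / (a - of_real (\<theta> * \<epsilon>))))"
      using A(3) e \<theta> by (intro sum_mono Re_inverse_ge_of_shift) auto
    also have "\<dots> = S" unfolding S_def B_def \<delta>_def by (subst sum.reindex) (auto simp: inj_on_def)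
    finally have "(1 - \<theta>) * (\<Sum>a\<in>A. Re (1 / a)) \<le> (1 - \<theta>) * (c * (K + ln r))"
      using S by (simp add: \<theta>(3) mult_ac)
    then have "(\<Sum>a\<in>A. Re (1 / a)) \<le> c * (K + ln r)" using \<theta> by simp
    then show "(\<Sum>a\<in>A. Re (1 / a)) \<le> c * ln r + c * K" by (simp add: algebra_simps)
  qed
qed


text \<open>
  The logarithmic bound holds for all finite sets of zeros with one constant, hence it also bounds the
  possibly infinite sums in the density condition; after division by \<open>log R\<close> only \<open>c\<close> remains,
  and \<open>c\<close> may be taken below \<open>2/\<pi>\<close> because \<open>\<pi> < 4\<close>.
\<close>

theorem vanishes_if_zeros_dense:
  fixes z :: "nat \<Rightarrow> complex"
  assumes holF: "F holomorphic_on right_half_plane"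
    and growth: "\<And>\<delta>. 0 < \<delta> \<Longrightarrow> \<exists>C. \<forall>w. \<delta> \<le> Re w \<longrightarrow>
      cmod (F w) \<le> exp (C * (1 + Re w) + Re w * ln (1 + cmod w))"
    and zeros: "\<And>j. F (z j) = 0"
    and z: "inj z" "0 < \<epsilon>" "\<And>j. \<epsilon> \<le> Re (z j)"
    and density: "Limsup at_top (\<lambda>R::real.
           (\<Sum>\<^sub>\<infinity>j\<in>{j. cmod (z j) \<le> R}. ennreal (Re (1 / z j))) / ennreal (ln R))
         > ennreal (2 / pi)"
    and w: "w \<in> right_half_plane"
  shows "F w = 0"
proof (rule ccontr)
  assume nz: "F w \<noteq> 0"
  have "1 / 2 < 2 / pi" using pi_less_4 pi_gt_zero by (simp add: field_simps)
  from dense[OF this] obtain c where c: "1 / 2 < c" "c < 2 / pi" by auto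
  from reciprocal_zero_sum_log_bound[OF holF growth w nz z(2) c(1)] obtain K where
    K: "\<forall>A r. finite A \<and> 1 \<le> r \<and> (\<forall>a\<in>A. F a = 0 \<and> \<epsilon> \<le> Re a \<and> cmod a \<le> r)
      \<longrightarrow> (\<Sum>a\<in>A. Re (1 / a)) \<le> c * ln r + K"
    by (rule exE)
  have "Limsup at_top (\<lambda>R::real.
           (\<Sum>\<^sub>\<infinity>j\<in>{j. cmod (z j) \<le> R}. ennreal (Re (1 / z j))) / ennreal (ln R))
      \<le> Limsup at_top (\<lambda>R::real. ennreal (c + \<bar>K\<bar> / ln R))"
  proof (rule Limsup_mono)
    show "\<forall>\<^sub>F R::real in at_top. (\<Sum>\<^sub>\<infinity>j\<in>{j. cmod (z j) \<le> R}. ennreal (Re (1 / z j))) / ennreal (ln R)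
        \<le> ennreal (c + \<bar>K\<bar> / ln R)"
      using eventually_gt_at_top[of "1::real"]
    proof eventually_elim
      case (elim R)
      have "(\<Sum>\<^sub>\<infinity>j\<in>{j. cmod (z j) \<le> R}. ennreal (Re (1 / z j))) \<le> ennreal (c * ln R + \<bar>K\<bar>)"
      proof (subst nonneg_infsum_complete, simp, rule SUP_least)
        fix J assume "J \<in> {F. finite F \<and> F \<subseteq> {j. cmod (z j) \<le> R}}"
        then have J: "finite J" "\<And>j. j \<in> J \<Longrightarrow> cmod (z j) \<le> R" by auto
        have nonneg: "0 \<le> Re (1 / z j)" for j
        proof -
          have "0 \<le> Re (z j)" using z(2) z(3)[of j] by linarith
          then show ?thesis by (simp add: Re_divide)
        qed
        have "(\<Sum>j\<in>J. Re (1 / z j)) = (\<Sum>a\<in>z ` J. Re (1 / a))"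
          using z(1) by (subst sum.reindex) (auto intro: inj_on_subset)
        also have "\<dots> \<le> c * ln R + K"
          using J elim zeros z(3) by (intro K[rule_format]) auto
        also have "\<dots> \<le> c * ln R + \<bar>K\<bar>" by simp
        finally show "(\<Sum>j\<in>J. ennreal (Re (1 / z j))) \<le> ennreal (c * ln R + \<bar>K\<bar>)"
          by (simp add: sum_ennreal nonneg ennreal_leI)
      qed
      then have "(\<Sum>\<^sub>\<infinity>j\<in>{j. cmod (z j) \<le> R}. ennreal (Re (1 / z j))) / ennreal (ln R)
          \<le> ennreal (c * ln R + \<bar>K\<bar>) / ennreal (ln R)"
        by (rule divide_right_mono_ennreal)
      also have "\<dots> = ennreal ((c * ln R + \<bar>K\<bar>) / ln R)"
        using elim c by (intro divide_ennreal) auto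
      also have "(c * ln R + \<bar>K\<bar>) / ln R = c + \<bar>K\<bar> / ln R"
        using elim by (simp add: field_simps)
      finally show ?case .
    qed
  qed
  also have "\<dots> = ennreal c"
  proof (rule lim_imp_Limsup)
    have "((\<lambda>R::real. c + \<bar>K\<bar> / ln R) \<longlongrightarrow> c + 0) at_top"
      by (intro tendsto_add tendsto_const tendsto_divide_0[OF tendsto_const]
          filterlim_at_top_imp_at_infinity ln_at_top)
    then show "((\<lambda>R::real. ennreal (c + \<bar>K\<bar> / ln R)) \<longlongrightarrow> ennreal c) at_top"
      by (intro tendsto_ennrealI) simp
  qed simp
  also have "\<dots> < ennreal (2 / pi)" using c by (simp add: ennreal_less_iff)
  finally show False using density by simp
qed

section \<open>Growth of functions in the weighted Hardy space\<close>

text \<open>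
  A Phragmen-Lindelof argument for bounded functions: \<open>exp (e w\<^sup>2)\<close> is harmless on the edges and
  tends to zero in the vertical directions of the strip, so that the bound \<open>M\<close> propagates from the
  edges; in the end \<open>e\<close> tends to zero.
\<close>

lemma strip_maximum_principle:
  fixes g :: "complex \<Rightarrow> complex" and a b B M :: real
  assumes hol: "g holomorphic_on U" and U: "open U" "{w. a \<le> Re w \<and> Re w \<le> b} \<subseteq> U"
    and ab: "0 \<le> a" and M: "0 < M"
    and bdd: "\<And>w. a \<le> Re w \<Longrightarrow> Re w \<le> b \<Longrightarrow> cmod (g w) \<le> B"
    and edges: "\<And>w. Re w = a \<or> Re w = b \<Longrightarrow> cmod (g w) \<le> M"
    and w: "a \<le> Re w" "Re w \<le> b"
  shows "cmod (g w) \<le> M"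
proof -
  have B0: "0 \<le> B" using bdd[OF w] norm_ge_zero order_trans by blast
  have main: "cmod (g w) \<le> M * exp (e * (b\<^sup>2 - (Re w)\<^sup>2 + (Im w)\<^sup>2))" if e: "0 < e" for e
  proof -
    \<comment> \<open>The height \<open>T\<close> is large enough for \<open>B exp (- e T\<^sup>2) \<le> M\<close>, since \<open>e T\<^sup>2 \<ge> B / M\<close>.\<close>
    define T where "T = \<bar>Im w\<bar> + B / (M * e) + 1"
    have T: "\<bar>Im w\<bar> \<le> T" "1 \<le> T" "B / (M * e) \<le> T" using B0 M e by (auto simp: T_def)
    have "B / M \<le> e * T\<^sup>2"
    proof -
      have "B / M = e * (B / (M * e))" using e by simp
      also have "\<dots> \<le> e * T\<^sup>2"
        using T e self_le_power[of T 2] by (intro mult_left_mono) auto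
      finally show ?thesis .
    qed
    then have "B / M \<le> exp (e * T\<^sup>2)" using exp_ge_add_one_self[of "e * T\<^sup>2"] by linarith
    then have BM: "B * exp (- (e * T\<^sup>2)) \<le> M" using M by (simp add: field_simps exp_minus)
    define h where "h w = g w * exp (of_real e * w\<^sup>2)" for w
    have nh: "cmod (h v) = cmod (g v) * exp (e * (Re v)\<^sup>2) * exp (- (e * (Im v)\<^sup>2))" for v
      by (simp add: h_def norm_mult norm_exp_eq_Re Re_power2 right_diff_distrib exp_diff exp_minus field_simps)
    have "cmod (h w) \<le> M * exp (e * b\<^sup>2)"
    proof (rule maximum_modulus_frontier[of h "cbox (Complex a (- T)) (Complex b T)"])
      have sub: "cbox (Complex a (- T)) (Complex b T) \<subseteq> U"
        using U(2) by (auto simp: in_cbox_complex_iff)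
      have hU: "h holomorphic_on U" unfolding h_def by (intro holomorphic_intros hol)
      show "h holomorphic_on interior (cbox (Complex a (- T)) (Complex b T))"
        using hU sub interior_subset holomorphic_on_subset by blast
      show "continuous_on (closure (cbox (Complex a (- T)) (Complex b T))) h"
        using hU sub by (simp add: holomorphic_on_imp_continuous_on holomorphic_on_subset)
      show "w \<in> cbox (Complex a (- T)) (Complex b T)"
        using w T by (auto simp: in_cbox_complex_iff)
      fix v assume "v \<in> frontier (cbox (Complex a (- T)) (Complex b T))"
      then have v: "a \<le> Re v" "Re v \<le> b" "Re v = a \<or> Re v = b \<or> \<bar>Im v\<bar> = T"
        by (auto simp: frontier_cbox in_cbox_complex_iff in_box_complex_iff)
      have x2: "e * (Re v)\<^sup>2 \<le> e * b\<^sup>2" using v ab e by (intro mult_left_mono power_mono) auto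
      have "cmod (g v) * exp (- (e * (Im v)\<^sup>2)) \<le> M"
      proof (cases "\<bar>Im v\<bar> = T")
        case True
        then have "(Im v)\<^sup>2 = T\<^sup>2" by (metis power2_abs)
        then have "cmod (g v) * exp (- (e * (Im v)\<^sup>2)) \<le> B * exp (- (e * T\<^sup>2))"
          using bdd[OF v(1,2)] by simp
        then show ?thesis using BM by linarith
      next
        case False
        then have "cmod (g v) \<le> M" using edges v by auto
        moreover have "exp (- (e * (Im v)\<^sup>2)) \<le> 1" using e by simp
        ultimately have "cmod (g v) * exp (- (e * (Im v)\<^sup>2)) \<le> M * 1" using M by (intro mult_mono) auto
        then show ?thesis by simp
      qed
      then have "cmod (g v) * exp (- (e * (Im v)\<^sup>2)) * exp (e * (Re v)\<^sup>2) \<le> M * exp (e * b\<^sup>2)"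
        using x2 M by (intro mult_mono) auto
      then show "cmod (h v) \<le> M * exp (e * b\<^sup>2)" by (simp add: nh mult_ac)
    qed auto
    then have "cmod (g w) \<le> M * exp (e * b\<^sup>2) * exp (- (e * (Re w)\<^sup>2)) * exp (e * (Im w)\<^sup>2)"
      by (simp add: nh exp_minus field_simps)
    also have "\<dots> = M * exp (e * (b\<^sup>2 - (Re w)\<^sup>2 + (Im w)\<^sup>2))"
      by (simp add: algebra_simps exp_add exp_minus exp_diff divide_inverse)
    finally show ?thesis .
  qed
  have "((\<lambda>e. M * exp (e * (b\<^sup>2 - (Re w)\<^sup>2 + (Im w)\<^sup>2))) \<longlongrightarrow> M * exp (0 * (b\<^sup>2 - (Re w)\<^sup>2 + (Im w)\<^sup>2))) (at_right 0)"
    by (intro tendsto_intros)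
  moreover have "eventually (\<lambda>e. cmod (g w) \<le> M * exp (e * (b\<^sup>2 - (Re w)\<^sup>2 + (Im w)\<^sup>2))) (at_right 0)"
    using main by (intro eventually_at_rightI[of 0 1]) auto
  ultimately have "cmod (g w) \<le> M * exp (0 * (b\<^sup>2 - (Re w)\<^sup>2 + (Im w)\<^sup>2))"
    by (rule tendsto_lowerbound) auto
  then show ?thesis by simp
qed

text \<open>
  The hypotheses on \<open>f\<close> control only its square means on vertical lines, while the maximum principle
  needs pointwise bounds. Integrals of \<open>f\<close> over vertical segments of length at most one, which are increments of a
  primitive, are bounded pointwise by the norm on the line, by the Cauchy-Schwarz inequality.
\<close>

lemma primitive_increment_le_line_norm:
  fixes f P :: "complex \<Rightarrow> complex" and h m :: real
  assumes holf: "f holomorphic_on right_half_plane"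
    and P: "\<And>w. w \<in> right_half_plane \<Longrightarrow> (P has_field_derivative f w) (at w)"
    and w: "w \<in> right_half_plane" and h: "0 \<le> h" "h \<le> 1" and m: "0 < m"
    and I: "(\<integral>\<^sup>+ y. ennreal ((cmod (f (Complex (Re w) y)))\<^sup>2) \<partial>lborel) \<le> ennreal (m\<^sup>2)"
  shows "cmod (P (w + \<i> * of_real h) - P w) \<le> m"
proof -
  have contf: "continuous_on right_half_plane f" using holf holomorphic_on_imp_continuous_on by blast
  have inR: "w + \<i> * of_real t \<in> right_half_plane" for t :: real
    using w by (simp add: right_half_plane_def)
  define \<phi> where "\<phi> t = f (w + \<i> * of_real t)" for t :: real
  have cont\<phi>: "continuous_on UNIV \<phi>" unfolding \<phi>_def
    by (rule continuous_on_compose2[OF contf]) (use inR in \<open>auto intro!: continuous_intros\<close>)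
  have "((\<lambda>t. \<i> * \<phi> t) has_integral P (w + \<i> * of_real h) - P (w + \<i> * of_real 0)) {0..h}"
  proof (rule fundamental_theorem_of_calculus[OF h(1)])
    fix t assume "t \<in> {0..h}"
    have "((\<lambda>t. P (w + \<i> * of_real t)) has_vector_derivative (\<i> * f (w + \<i> * of_real t))) (at t within {0..h})"
      by (rule field_vector_diff_chain_within[unfolded o_def, where g = P])
        (auto intro!: derivative_eq_intros has_field_derivative_at_within[OF P] inR)
    then show "((\<lambda>t. P (w + \<i> * of_real t)) has_vector_derivative \<i> * \<phi> t) (at t within {0..h})"
      by (simp add: \<phi>_def)
  qed
  then have int: "integral {0..h} (\<lambda>t. \<i> * \<phi> t) = P (w + \<i> * of_real h) - P w"
    and ig: "(\<lambda>t. \<i> * \<phi> t) integrable_on {0..h}" by (auto simp: has_integral_iff)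
  have c2: "continuous_on {0..h} (\<lambda>t. (cmod (\<phi> t))\<^sup>2)"
    using cont\<phi> by (intro continuous_intros) (auto intro: continuous_on_subset)
  then have i2: "(\<lambda>t. (cmod (\<phi> t))\<^sup>2) integrable_on {0..h}" by (rule integrable_continuous_real)
  have si: "set_integrable lborel {0..h} (\<lambda>t. (cmod (\<phi> t))\<^sup>2)"
    using c2 by (rule borel_integrable_atLeastAtMost')
  have J: "integral {0..h} (\<lambda>t. (cmod (\<phi> t))\<^sup>2) \<le> m\<^sup>2"
  proof -
    have "ennreal (integral {0..h} (\<lambda>t. (cmod (\<phi> t))\<^sup>2)) = ennreal (LINT t|lborel. indicator {0..h} t *\<^sub>R (cmod (\<phi> t))\<^sup>2)"
      using set_borel_integral_eq_integral(2)[OF si] by (simp add: set_lebesgue_integral_def)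
    also have "\<dots> = (\<integral>\<^sup>+ t. ennreal (indicator {0..h} t *\<^sub>R (cmod (\<phi> t))\<^sup>2) \<partial>lborel)"
      using si by (intro nn_integral_eq_integral[symmetric]) (auto simp: set_integrable_def)
    also have "\<dots> \<le> (\<integral>\<^sup>+ t. ennreal ((cmod (f (Complex (Re w) (Im w + 1 * t))))\<^sup>2) \<partial>lborel)"
    proof (intro nn_integral_mono ennreal_leI)
      fix t
      have "Complex (Re w) (Im w + 1 * t) = w + \<i> * of_real t" by (simp add: complex_eq_iff)
      then show "indicator {0..h} t *\<^sub>R (cmod (\<phi> t))\<^sup>2 \<le> (cmod (f (Complex (Re w) (Im w + 1 * t))))\<^sup>2"
        by (simp add: \<phi>_def indicator_def)
    qed
    also have "\<dots> = (\<integral>\<^sup>+ y. ennreal ((cmod (f (Complex (Re w) y)))\<^sup>2) \<partial>lborel)"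
    proof -
      have "continuous_on UNIV (\<lambda>y. f (Complex (Re w) y))"
        by (rule continuous_on_compose2[OF contf]) 
          (use w in \<open>auto intro!: continuous_intros simp: right_half_plane_def Complex_eq\<close>)
      then have "(\<lambda>y. f (Complex (Re w) y)) \<in> borel_measurable borel"
        by (rule borel_measurable_continuous_onI)
      then show ?thesis
        by (subst (2) nn_integral_real_affine[of _ 1 "Im w"]) auto
    qed
    also have "\<dots> \<le> ennreal (m\<^sup>2)" by (rule I)
    finally show ?thesis by (simp add: ennreal_le_iff)
  qed
  have "cmod (integral {0..h} (\<lambda>t. \<i> * \<phi> t)) \<le> integral {0..h} (\<lambda>t. (cmod (\<phi> t))\<^sup>2 / (2 * m) + m / 2)"
  proof (rule integral_norm_bound_integral[OF ig])
    show "(\<lambda>t. (cmod (\<phi> t))\<^sup>2 / (2 * m) + m / 2) integrable_on {0..h}"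
      using i2 by (intro integrable_add) (auto intro!: integrable_on_divide)
    fix t
    \<comment> \<open>Cauchy-Schwarz in the form of the inequality between the arithmetic and geometric means.\<close>
    have "0 \<le> (cmod (\<phi> t) - m)\<^sup>2 / (2 * m)" using m by simp
    also have "\<dots> = (cmod (\<phi> t))\<^sup>2 / (2 * m) + m / 2 - cmod (\<phi> t)"
      using m by (simp add: power2_eq_square field_simps)
    finally show "cmod (\<i> * \<phi> t) \<le> (cmod (\<phi> t))\<^sup>2 / (2 * m) + m / 2" by (simp add: norm_mult)
  qed
  also have "\<dots> = integral {0..h} (\<lambda>t. (cmod (\<phi> t))\<^sup>2) / (2 * m) + h * (m / 2)"
    using i2 h by (subst integral_add) (auto intro!: integrable_on_divide)
  also have "\<dots> \<le> m\<^sup>2 / (2 * m) + 1 * (m / 2)"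
    using J m h by (intro add_mono divide_right_mono mult_right_mono) auto
  also have "\<dots> = m" using m by (simp add: power2_eq_square field_simps)
  finally show ?thesis using int by simp
qed


lemma M2_omega_line_norm_bound:
  assumes "f \<in> M2_omega"
  obtains T where "0 < T" "\<And>n. 1 \<le> n \<Longrightarrow>
    (\<integral>\<^sup>+ y. ennreal ((cmod (f (Complex (real n / 2) y)))\<^sup>2) \<partial>lborel) \<le> ennreal (T * (1 + real n / 2) ^ n)"
proof -
  from assms obtain g where
    g: "extend_by_boundary f g \<in> borel_measurable omega_measure"
       "(\<integral>\<^sup>+ z. ennreal ((cmod (extend_by_boundary f g z))\<^sup>2) \<partial>omega_measure) < \<infinity>"
    unfolding M2_omega_def by blast
  let ?F = "\<lambda>z. ennreal ((cmod (extend_by_boundary f g z))\<^sup>2)"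
  let ?I = "\<lambda>n. \<integral>\<^sup>+ y. ?F (Complex (real n / 2) y) \<partial>lborel"
  have "sets omega_measure = sets borel" by (simp add: omega_measure_def)
  then have "extend_by_boundary f g \<in> borel_measurable borel"
    using g(1) measurable_cong_sets by blast
  then have "?F \<in> borel_measurable borel" by simp
  then have sum: "(\<Sum>n. ennreal (2 ^ n / fact n) * ?I n) < \<infinity>"
    using g(2) by (subst nn_integral_omega_measure[symmetric])
  then obtain T where T: "0 \<le> T" "(\<Sum>n. ennreal (2 ^ n / fact n) * ?I n) = ennreal T"
    by (cases "\<Sum>n. ennreal (2 ^ n / fact n) * ?I n" rule: ennreal_cases) simp_all
  show ?thesis
  proof (rule that[of "T + 1"])
    show "0 < T + 1" using T by simp
    fix n :: nat assume n: "1 \<le> n"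
    have I: "(\<integral>\<^sup>+ y. ennreal ((cmod (f (Complex (real n / 2) y)))\<^sup>2) \<partial>lborel) = ?I n"
      using n by (simp add: extend_by_boundary_def)
    have "ennreal (2 ^ n / fact n) * ?I n \<le> (\<Sum>n. ennreal (2 ^ n / fact n) * ?I n)"
      using sum_le_suminf[OF summableI, of "{n}" "\<lambda>n. ennreal (2 ^ n / fact n) * ?I n"] by simp
    then have *: "ennreal (2 ^ n / fact n) * ?I n \<le> ennreal T" using T by simp
    have "?I n = ennreal (fact n / 2 ^ n) * (ennreal (2 ^ n / fact n) * ?I n)"
      by (subst mult.assoc[symmetric], subst ennreal_mult[symmetric]) auto
    also have "\<dots> \<le> ennreal (fact n / 2 ^ n) * ennreal T"
      using * by (rule mult_left_mono) simp
    also have "\<dots> = ennreal (fact n / 2 ^ n * T)" using T by (intro ennreal_mult[symmetric]) auto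
    also have "\<dots> \<le> ennreal ((T + 1) * (1 + real n / 2) ^ n)"
    proof (rule ennreal_leI)
      have "(fact n :: real) \<le> real n ^ n"
        using fact_le_power[of n] by simp
      then have "fact n / 2 ^ n \<le> (real n / 2) ^ n" by (simp add: power_divide divide_right_mono)
      also have "\<dots> \<le> (1 + real n / 2) ^ n" by (intro power_mono) auto
      finally have "fact n / 2 ^ n * T \<le> (1 + real n / 2) ^ n * (T + 1)"
        using T by (intro mult_mono) auto
      then show "fact n / 2 ^ n * T \<le> (T + 1) * (1 + real n / 2) ^ n" by (simp add: mult.commute)
    qed
    finally show "(\<integral>\<^sup>+ y. ennreal ((cmod (f (Complex (real n / 2) y)))\<^sup>2) \<partial>lborel)
        \<le> ennreal ((T + 1) * (1 + real n / 2) ^ n)" unfolding I .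
  qed
qed

lemma hardy2_strip_line_norm_bound:
  assumes "f \<in> hardy2_strip b"
  obtains S where "0 < S" "\<And>x. 0 < x \<Longrightarrow> x < b \<Longrightarrow>
    (\<integral>\<^sup>+ y. ennreal ((cmod (f (Complex x y)))\<^sup>2) \<partial>lborel) \<le> ennreal (S\<^sup>2)"
proof -
  let ?I = "\<lambda>x. \<integral>\<^sup>+ y. ennreal ((cmod (f (Complex x y)))\<^sup>2) \<partial>lborel"
  have "(SUP x\<in>{0<..<b}. ?I x) < \<infinity>" using assms by (simp add: hardy2_strip_def)
  then obtain T where T: "0 \<le> T" "(SUP x\<in>{0<..<b}. ?I x) = ennreal T"
    by (cases "SUP x\<in>{0<..<b}. ?I x" rule: ennreal_cases) simp_all
  show ?thesis
  proof (rule that[of "T + 1"])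
    show "0 < T + 1" using T by simp
    fix x assume "0 < x" "x < b"
    then have "?I x \<le> (SUP x\<in>{0<..<b}. ?I x)" by (intro SUP_upper) auto
    also have "\<dots> = ennreal T" by (rule T)
    also have "\<dots> \<le> ennreal ((T + 1)\<^sup>2)"
      using T by (intro ennreal_leI) (simp add: power2_eq_square algebra_simps)
    finally show "?I x \<le> ennreal ((T + 1)\<^sup>2)" .
  qed
qed

text \<open>
  The integrals \<open>g h w\<close> of \<open>f\<close> over the vertical segments of length \<open>h \<le> 1\<close> above \<open>w\<close> are bounded on the lines
  \<open>\<Re>w = n/2\<close> by the norms there, and by the strip maximum principle they keep this bound in
  between; near the imaginary axis the Hardy space bound suffices. To return to \<open>f\<close> itself, note that the derivative of \<open>g h\<close> at \<open>w\<close> is \<open>f (w + \<i> h) - f w\<close>, which is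
  controlled by Cauchy's estimate: on the segment above \<open>w\<close> the function \<open>f\<close> differs little from
  \<open>f w\<close>, so that \<open>\<i> f w\<close> is close to \<open>g 1 w\<close>.
\<close>

lemma M2_omega_growth:
  assumes f: "f \<in> M2_omega" and \<delta>: "0 < \<delta>"
  shows "\<exists>C. \<forall>w. \<delta> \<le> Re w \<longrightarrow> cmod (f w) \<le> exp (C * (1 + Re w) + Re w * ln (1 + cmod w))"
proof -
  have holf: "f holomorphic_on right_half_plane" and hardy: "\<And>b. 0 < b \<Longrightarrow> f \<in> hardy2_strip b"
    using f by (auto simp: M2_omega_def)
  have opR: "open right_half_plane" and cvR: "convex right_half_plane"
    by (auto simp: right_half_plane_def open_halfspace_Re_gt convex_halfspace_Re_gt)
  obtain P where P: "\<And>w. w \<in> right_half_plane \<Longrightarrow> (P has_field_derivative f w) (at w)"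
    using holomorphic_convex_primitive'[OF cvR opR holf] opR by (metis at_within_open)
  have holP: "P holomorphic_on right_half_plane"
    using P by (auto simp: holomorphic_on_open[OF opR])
  define g where "g h w = P (w + \<i> * of_real h) - P w" for h :: real and w
  have shift: "w + \<i> * of_real h \<in> right_half_plane" if "w \<in> right_half_plane" for w and h :: real
    using that by (simp add: right_half_plane_def)
  have gder: "(g h has_field_derivative f (w + \<i> * of_real h) - f w) (at w)" 
    if "w \<in> right_half_plane" for w h
  proof -
    have "((\<lambda>w. P (w + \<i> * of_real h)) has_field_derivative f (w + \<i> * of_real h) * 1) (at w)"
      by (rule DERIV_chain2[where f = P and g = "\<lambda>w. w + \<i> * of_real h", OF P[OF shift[OF that]]]) (auto intro!: derivative_eq_intros)
    then show ?thesis unfolding g_def using DERIV_diff[OF _ P[OF that]] by fastforce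
  qed
  have holg: "g h holomorphic_on right_half_plane" for h
    using gder by (auto simp: holomorphic_on_open[OF opR])
  have line: "cmod (g h w) \<le> m"
    if "w \<in> right_half_plane" "0 \<le> h" "h \<le> 1" "0 < m"
      "(\<integral>\<^sup>+ y. ennreal ((cmod (f (Complex (Re w) y)))\<^sup>2) \<partial>lborel) \<le> ennreal (m\<^sup>2)" for h w m
    unfolding g_def using primitive_increment_le_line_norm[OF holf P that] by blast
  obtain T where T: "0 < T" "\<And>n. 1 \<le> n \<Longrightarrow>
    (\<integral>\<^sup>+ y. ennreal ((cmod (f (Complex (real n / 2) y)))\<^sup>2) \<partial>lborel) \<le> ennreal (T * (1 + real n / 2) ^ n)"
    using M2_omega_line_norm_bound[OF f] by blast
  define m where "m n = sqrt T * (1 + real n / 2) powr (real n / 2)" for n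
  have m2: "(m n)\<^sup>2 = T * (1 + real n / 2) ^ n" for n
  proof -
    have "((1 + real n / 2) powr (real n / 2))\<^sup>2 = (1 + real n / 2) powr (real n)"
      by (simp add: power2_eq_square flip: powr_add)
    also have "\<dots> = (1 + real n / 2) ^ n" by (rule powr_realpow) (auto intro: add_pos_nonneg)
    finally show ?thesis using T by (simp add: m_def power_mult_distrib)
  qed
  have m0: "0 < m n" for n using T(1) by (simp add: m_def)
  have mle: "m n \<le> sqrt T * (2 + x) powr (x + 1)" if "real n / 2 \<le> x + 1 / 2" for n x
  proof -
    have "(1 + real n / 2) powr (real n / 2) \<le> (2 + x) powr (real n / 2)"
      using that by (intro powr_mono2) auto
    also have "\<dots> \<le> (2 + x) powr (x + 1)" 
      using that of_nat_0_le_iff[of n] by (intro powr_mono) linarith+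
    finally show ?thesis using T by (auto simp: m_def intro: mult_left_mono)
  qed
  obtain S where S: "0 < S" "\<And>x. 0 < x \<Longrightarrow> x < 1 \<Longrightarrow>
    (\<integral>\<^sup>+ y. ennreal ((cmod (f (Complex x y)))\<^sup>2) \<partial>lborel) \<le> ennreal (S\<^sup>2)"
    using hardy2_strip_line_norm_bound[OF hardy[of 1]] by auto
  define C3 where "C3 = sqrt T + S + 1"
  have C3: "1 \<le> C3" using S T by (simp add: C3_def)
  have gb: "cmod (g h w) \<le> C3 * (2 + Re w) powr (Re w + 1)" if w: "0 < Re w" and h: "0 \<le> h" "h \<le> 1" for h w
  proof (cases "Re w < 1 / 2")
    case True
    have "cmod (g h w) \<le> S"
      by (rule line) (use w h True S in \<open>auto simp: right_half_plane_def\<close>)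
    also have "S \<le> C3 * 1" using T by (simp add: C3_def)
    also have "\<dots> \<le> C3 * (2 + Re w) powr (Re w + 1)"
      using C3 w by (intro mult_left_mono ge_one_powr_ge_zero) auto
    finally show ?thesis .
  next
    case False
    define n where "n = nat \<lfloor>2 * Re w\<rfloor>"
    have "real n = real_of_int \<lfloor>2 * Re w\<rfloor>" using False by (simp add: n_def)
    then have "real n \<le> 2 * Re w" "2 * Re w < real n + 1"
      by (simp_all add: floor_less_iff)
    then have n: "1 \<le> n" "real n / 2 \<le> Re w" "Re w \<le> real (Suc n) / 2"
      using False by auto
    have mm: "m n \<le> m (Suc n)"
    proof -
      have "(1 + real n / 2) powr (real n / 2) \<le> (1 + real (Suc n) / 2) powr (real n / 2)"
        by (intro powr_mono2) auto
      also have "\<dots> \<le> (1 + real (Suc n) / 2) powr (real (Suc n) / 2)"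
        by (intro powr_mono) auto
      finally show ?thesis using T by (auto simp: m_def intro: mult_left_mono)
    qed
    obtain B where B: "0 < B" "\<And>x. 0 < x \<Longrightarrow> x < real n + 2 \<Longrightarrow>
      (\<integral>\<^sup>+ y. ennreal ((cmod (f (Complex x y)))\<^sup>2) \<partial>lborel) \<le> ennreal (B\<^sup>2)"
      using hardy2_strip_line_norm_bound[OF hardy[of "real n + 2"]] by auto
    have "cmod (g h w) \<le> m (Suc n)"
    proof (rule strip_maximum_principle[OF holg opR, of "real n / 2" "real (Suc n) / 2"])
      show "{w. real n / 2 \<le> Re w \<and> Re w \<le> real (Suc n) / 2} \<subseteq> right_half_plane"
        using n by (auto simp: right_half_plane_def)
      fix v assume v: "real n / 2 \<le> Re v" "Re v \<le> real (Suc n) / 2"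
      show "cmod (g h v) \<le> B"
        by (rule line) (use v n h B in \<open>auto simp: right_half_plane_def\<close>)
    next
      fix v assume "Re v = real n / 2 \<or> Re v = real (Suc n) / 2"
      then obtain k where k: "k = n \<or> k = Suc n" "Re v = real k / 2" by blast
      have "cmod (g h v) \<le> m k"
      proof (rule line)
        have "1 \<le> k" using k n by auto
        then show "v \<in> right_half_plane" using k by (simp add: right_half_plane_def)
        show "(\<integral>\<^sup>+ y. ennreal ((cmod (f (Complex (Re v) y)))\<^sup>2) \<partial>lborel) \<le> ennreal ((m k)\<^sup>2)"
          unfolding k(2) m2 by (rule T(2)[OF \<open>1 \<le> k\<close>])
      qed (use h m0 in auto)
      then show "cmod (g h v) \<le> m (Suc n)" using k mm by auto
    qed (use n m0 in auto)
    also have "\<dots> \<le> sqrt T * (2 + Re w) powr (Re w + 1)" using n by (intro mle) auto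
    also have "\<dots> \<le> C3 * (2 + Re w) powr (Re w + 1)"
      using S by (intro mult_right_mono) (auto simp: C3_def)
    finally show ?thesis .
  qed
  \<comment> \<open>The radius in Cauchy's estimate keeps the discs inside the half plane.\<close>
  define \<rho> where "\<rho> = min \<delta> 1 / 2"
  have \<rho>: "0 < \<rho>" "\<rho> < \<delta>" "\<rho> \<le> 1" using \<delta> by (auto simp: \<rho>_def)
  define C4 where "C4 = C3 * (1 + 1 / \<rho>)"
  have C4: "1 \<le> C4" using C3 \<rho> mult_mono[of 1 C3 1 "1 + 1 / \<rho>"] by (simp add: C4_def)
  have fb: "cmod (f w) \<le> C4 * (3 + Re w) powr (Re w + 2)" if w: "\<delta> \<le> Re w" for w
  proof -
    define B where "B = C3 * (3 + Re w) powr (Re w + 2)"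
    have wR: "w \<in> right_half_plane" using w \<delta> by (simp add: right_half_plane_def)
    have near: "0 < Re v \<and> cmod (g h v) \<le> B" if "dist w v \<le> \<rho>" "0 \<le> h" "h \<le> 1" for v h
    proof -
      have v: "\<bar>Re w - Re v\<bar> \<le> \<rho>" using that(1) abs_Re_le_cmod[of "w - v"] by (simp add: dist_norm)
      then have v0: "0 < Re v" "Re v \<le> Re w + 1" using w \<rho> by linarith+
      have "cmod (g h v) \<le> C3 * (2 + Re v) powr (Re v + 1)" using gb v0 that by blast
      also have "(2 + Re v) powr (Re v + 1) \<le> (3 + Re w) powr (Re v + 1)"
        using v0 by (intro powr_mono2) auto
      also have "\<dots> \<le> (3 + Re w) powr (Re w + 2)" using v0 w \<delta> by (intro powr_mono) auto
      finally show ?thesis using v0 C3 by (simp add: B_def)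
    qed
    have cb: "cball w \<rho> \<subseteq> right_half_plane" using near[of _ 0] by (auto simp: right_half_plane_def)
    have der: "cmod (f (w + \<i> * of_real h) - f w) \<le> B / \<rho>" if h: "0 \<le> h" "h \<le> 1" for h
    proof -
      have "cmod ((deriv ^^ 1) (g h) w) \<le> fact 1 * B / \<rho> ^ 1"
      proof (rule Cauchy_inequality)
        show "g h holomorphic_on ball w \<rho>"
          using cb by (intro holomorphic_on_subset[OF holg]) (use ball_subset_cball in blast)
        show "continuous_on (cball w \<rho>) (g h)"
          using cb holg holomorphic_on_imp_continuous_on continuous_on_subset by blast
      qed (use near h \<rho> in \<open>auto simp: dist_norm\<close>)
      then show ?thesis using DERIV_imp_deriv[OF gder[OF wR, of h]] by simp
    qed
    have "norm ((P (w + \<i> * of_real 1) - \<i> * of_real 1 * f w) - (P (w + \<i> * of_real 0) - \<i> * of_real 0 * f w))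
        \<le> B / \<rho> * norm (1 - (0::real))"
    proof (rule differentiable_bound[of "{0..1::real}" "\<lambda>t. P (w + \<i> * of_real t) - \<i> * of_real t * f w"
          "\<lambda>t s. s *\<^sub>R (\<i> * (f (w + \<i> * of_real t) - f w))"])
      fix t :: real assume t: "t \<in> {0..1}"
      have "((\<lambda>t. P (w + \<i> * of_real t)) has_vector_derivative (\<i> * f (w + \<i> * of_real t))) (at t within {0..1})"
        by (rule field_vector_diff_chain_within[unfolded o_def, where g = P])
          (auto intro!: derivative_eq_intros has_field_derivative_at_within[OF P] shift wR)
      then have "((\<lambda>t. P (w + \<i> * of_real t) - \<i> * of_real t * f w) has_vector_derivative
          (\<i> * f (w + \<i> * of_real t) - \<i> * 1 * f w)) (at t within {0..1})"
        by (intro has_vector_derivative_diff has_vector_derivative_mult_left has_vector_derivative_mult_right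
            has_vector_derivative_of_real) (auto intro!: derivative_eq_intros)
      then show "((\<lambda>t. P (w + \<i> * of_real t) - \<i> * of_real t * f w) has_derivative
          (\<lambda>s. s *\<^sub>R (\<i> * (f (w + \<i> * of_real t) - f w)))) (at t within {0..1})"
        by (simp add: has_vector_derivative_def right_diff_distrib)
      show "onorm (\<lambda>s. s *\<^sub>R (\<i> * (f (w + \<i> * of_real t) - f w))) \<le> B / \<rho>"
      proof (rule onorm_le)
        fix s :: real
        have "\<bar>s\<bar> * cmod (f (w + \<i> * of_real t) - f w) \<le> \<bar>s\<bar> * (B / \<rho>)"
          using der[of t] t by (intro mult_left_mono) auto
        then show "norm (s *\<^sub>R (\<i> * (f (w + \<i> * of_real t) - f w))) \<le> B / \<rho> * norm s"
          by (simp add: norm_mult mult.commute)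
      qed
    qed auto
    then have "cmod (g 1 w - \<i> * f w) \<le> B / \<rho>" by (simp add: g_def algebra_simps)
    moreover have "cmod (g 1 w) \<le> B" using near[of w 1] \<rho> by simp
    ultimately have "cmod (\<i> * f w) \<le> B + B / \<rho>"
      using norm_triangle_sub[of "\<i> * f w" "g 1 w"] by (simp add: norm_minus_commute)
    also have "\<dots> = C4 * (3 + Re w) powr (Re w + 2)" by (simp add: B_def C4_def algebra_simps)
    finally show ?thesis by (simp add: norm_mult)
  qed
  show ?thesis
  proof (intro exI[of _ "ln C4 + 4 + ln 3"] allI impI)
    fix w assume w: "\<delta> \<le> Re w"
    have x: "0 < Re w" using w \<delta> by simp
    have l: "ln (3 + Re w) \<le> ln 3 + ln (1 + cmod w)"
    proof -
      have "ln (3 + Re w) \<le> ln (3 * (1 + cmod w))"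
        using x complex_Re_le_cmod[of w] by (subst ln_le_cancel_iff) (auto intro: add_pos_nonneg)
      also have "\<dots> = ln 3 + ln (1 + cmod w)"
        using norm_ge_zero[of w] by (subst ln_mult) (auto simp del: norm_ge_zero)
      finally show ?thesis .
    qed
    have "C4 * (3 + Re w) powr (Re w + 2) = exp (ln C4 + (Re w + 2) * ln (3 + Re w))"
      using C4 x by (simp add: powr_def exp_add)
    also have "\<dots> \<le> exp ((ln C4 + 4 + ln 3) * (1 + Re w) + Re w * ln (1 + cmod w))"
    proof (subst exp_le_cancel_iff)
      have arith: "L + (x + 2) * y \<le> (L + 4 + b) * (1 + x) + x * c"
        if "x * y \<le> x * (b + c)" "y \<le> 2 + x" "0 \<le> L * x" "0 \<le> b" "0 < x" for L b c x y :: real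
        using that by (simp add: algebra_simps)
      show "ln C4 + (Re w + 2) * ln (3 + Re w) \<le> (ln C4 + 4 + ln 3) * (1 + Re w) + Re w * ln (1 + cmod w)"
      proof (rule arith)
        show "Re w * ln (3 + Re w) \<le> Re w * (ln 3 + ln (1 + cmod w))"
          using l x by (intro mult_left_mono) auto
        show "ln (3 + Re w) \<le> 2 + Re w" using ln_le_minus_one[of "3 + Re w"] x by simp
      qed (use C4 x in auto)
    qed
    finally show "cmod (f w) \<le> exp ((ln C4 + 4 + ln 3) * (1 + Re w) + Re w * ln (1 + cmod w))"
      using fb[OF w] by linarith
  qed
qed

section \<open>Approximation in spaces of square integrable functions\<close>

text \<open>
  Square integrable functions are used as functions, not as classes modulo null sets, so the form
  \<open>L2_inner\<close> is only semidefinite; \<open>L2_sq\<close> is the square of its seminorm.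
\<close>

definition L2 :: "'a measure \<Rightarrow> ('a \<Rightarrow> complex) set" where
  "L2 M = {u \<in> borel_measurable M. integrable M (\<lambda>x. (cmod (u x))\<^sup>2)}"

definition L2_inner :: "'a measure \<Rightarrow> ('a \<Rightarrow> complex) \<Rightarrow> ('a \<Rightarrow> complex) \<Rightarrow> complex" where
  "L2_inner M u v = (\<integral>x. u x * cnj (v x) \<partial>M)"

definition L2_sq :: "'a measure \<Rightarrow> ('a \<Rightarrow> complex) \<Rightarrow> real" where
  "L2_sq M u = (\<integral>x. (cmod (u x))\<^sup>2 \<partial>M)"

lemma L2_measurable [measurable_dest]: "u \<in> L2 M \<Longrightarrow> u \<in> borel_measurable M"
  by (simp add: L2_def)

lemma L2_integrable: "u \<in> L2 M \<Longrightarrow> integrable M (\<lambda>x. (cmod (u x))\<^sup>2)"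
  by (simp add: L2_def)

lemma L2_sq_nonneg: "0 \<le> L2_sq M u"
  by (simp add: L2_sq_def)

lemma L2_I_le:
  assumes [measurable]: "u \<in> borel_measurable M" and g: "integrable M g"
    and le: "\<And>x. x \<in> space M \<Longrightarrow> (cmod (u x))\<^sup>2 \<le> g x"
  shows "u \<in> L2 M" "L2_sq M u \<le> integral\<^sup>L M g"
proof -
  have i: "integrable M (\<lambda>x. (cmod (u x))\<^sup>2)"
    by (rule Bochner_Integration.integrable_bound[OF g]) (use le in \<open>auto intro!: AE_I2\<close>, 
       meson abs_ge_self order_trans)
  then show "u \<in> L2 M" by (simp add: L2_def)
  show "L2_sq M u \<le> integral\<^sup>L M g"
    unfolding L2_sq_def by (rule integral_mono[OF i g le])
qed

lemma norm_add_square_le: "(cmod (a + b))\<^sup>2 \<le> 2 * (cmod a)\<^sup>2 + 2 * (cmod b)\<^sup>2"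
proof -
  have "(cmod (a + b))\<^sup>2 \<le> (cmod a + cmod b)\<^sup>2" by (intro power_mono norm_triangle_ineq) auto
  also have "\<dots> \<le> 2 * (cmod a)\<^sup>2 + 2 * (cmod b)\<^sup>2"
    using sum_squares_bound[of "cmod a" "cmod b"] by (simp add: power2_sum)
  finally show ?thesis .
qed

lemma L2_add:
  assumes u: "u \<in> L2 M" and v: "v \<in> L2 M"
  shows "(\<lambda>x. u x + v x) \<in> L2 M"
    and "L2_sq M (\<lambda>x. u x + v x) \<le> 2 * L2_sq M u + 2 * L2_sq M v"
proof -
  have g: "integrable M (\<lambda>x. 2 * (cmod (u x))\<^sup>2 + 2 * (cmod (v x))\<^sup>2)"
    using L2_integrable[OF u] L2_integrable[OF v] by auto
  have m: "(\<lambda>x. u x + v x) \<in> borel_measurable M" using u v by measurable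
  show "(\<lambda>x. u x + v x) \<in> L2 M" by (rule L2_I_le(1)[OF m g norm_add_square_le])
  show "L2_sq M (\<lambda>x. u x + v x) \<le> 2 * L2_sq M u + 2 * L2_sq M v"
    using L2_I_le(2)[OF m g norm_add_square_le] L2_integrable[OF u] L2_integrable[OF v]
    by (simp add: L2_sq_def)
qed

lemma L2_scale:
  assumes "u \<in> L2 M"
  shows "(\<lambda>x. c * u x) \<in> L2 M" "L2_sq M (\<lambda>x. c * u x) = (cmod c)\<^sup>2 * L2_sq M u"
  using assms by (auto simp: L2_def L2_sq_def norm_mult power_mult_distrib)

lemma L2_diff:
  assumes u: "u \<in> L2 M" and v: "v \<in> L2 M"
  shows "(\<lambda>x. u x - v x) \<in> L2 M"
    and "L2_sq M (\<lambda>x. u x - v x) \<le> 2 * L2_sq M u + 2 * L2_sq M v"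
  using L2_add[OF u L2_scale(1)[OF v, of "-1"]] L2_scale(2)[OF v, of "-1"] by auto

lemma L2_inner_integrable:
  assumes u: "u \<in> L2 M" and v: "v \<in> L2 M"
  shows "integrable M (\<lambda>x. u x * cnj (v x))"
proof (rule Bochner_Integration.integrable_bound)
  show "integrable M (\<lambda>x. (cmod (u x))\<^sup>2 + (cmod (v x))\<^sup>2)"
    using L2_integrable[OF u] L2_integrable[OF v] by auto
  have "(\<lambda>x. cnj (v x)) \<in> borel_measurable M"
    by (rule measurable_compose[OF L2_measurable[OF v] borel_measurable_continuous_onI])
      (auto intro: continuous_intros)
  then show "(\<lambda>x. u x * cnj (v x)) \<in> borel_measurable M" using u by measurable
  have "a * b \<le> \<bar>a\<^sup>2 + b\<^sup>2\<bar>" if "0 \<le> a" "0 \<le> b" for a b :: real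
    using sum_squares_bound[of a b] mult_nonneg_nonneg[OF that] by linarith
  then show "AE x in M. norm (u x * cnj (v x)) \<le> norm ((cmod (u x))\<^sup>2 + (cmod (v x))\<^sup>2)"
    by (auto simp: norm_mult)
qed

lemma L2_sq_diff_scaled:
  assumes u: "u \<in> L2 M" and v: "v \<in> L2 M"
  shows "L2_sq M (\<lambda>x. u x - c * v x)
    = L2_sq M u - 2 * Re (cnj c * L2_inner M u v) + (cmod c)\<^sup>2 * L2_sq M v"
proof -
  have iuv: "integrable M (\<lambda>x. u x * cnj (v x))" by (rule L2_inner_integrable[OF u v])
  define k where "k x = Re (cnj c * (u x * cnj (v x)))" for x
  have ik: "integrable M k" unfolding k_def using iuv by (intro integrable_Re) auto
  have eq: "(cmod (u x - c * v x))\<^sup>2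
      = (cmod (u x))\<^sup>2 - 2 * k x + (cmod c)\<^sup>2 * (cmod (v x))\<^sup>2" for x
    unfolding k_def cmod_power2 by (simp add: power2_eq_square algebra_simps)
  have "L2_sq M (\<lambda>x. u x - c * v x) = (\<integral>x. (cmod (u x))\<^sup>2 \<partial>M)
      - 2 * (\<integral>x. k x \<partial>M) + (\<integral>x. (cmod c)\<^sup>2 * (cmod (v x))\<^sup>2 \<partial>M)"
    unfolding L2_sq_def eq using ik L2_integrable[OF u] L2_integrable[OF v] by simp
  also have "(\<integral>x. k x \<partial>M) = Re (cnj c * L2_inner M u v)"
    unfolding L2_inner_def k_def using iuv by (subst integral_Re) auto
  finally show ?thesis by (simp add: L2_sq_def)
qed

text \<open>
  If no multiple of \<open>v\<close> brings \<open>u\<close> much closer to zero, then \<open>u\<close> is almost orthogonal to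
  \<open>v\<close>; the optimal multiple is \<open>L2_inner M u v / L2_sq M v\<close>. The Cauchy-Schwarz inequality is the
  special case in which \<open>e\<close> is the full square norm of \<open>u\<close>.
\<close>

lemma L2_best_approximation_inner_bound:
  assumes u: "u \<in> L2 M" and v: "v \<in> L2 M" and "0 \<le> e"
    and near: "\<And>c. L2_sq M u - e \<le> L2_sq M (\<lambda>x. u x - c * v x)"
  shows "(cmod (L2_inner M u v))\<^sup>2 \<le> e * L2_sq M v"
proof -
  define I where "I = L2_inner M u v"
  define q where "q = L2_sq M v"
  have *: "2 * t * (cmod I)\<^sup>2 - t\<^sup>2 * (cmod I)\<^sup>2 * q \<le> e" for t :: real
  proof -
    have "Re (cnj (of_real t * I) * I) = t * (cmod I)\<^sup>2"
      unfolding cmod_power2 by (simp add: power2_eq_square algebra_simps)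
    then show ?thesis
      using near[of "of_real t * I"] L2_sq_diff_scaled[OF u v, of "of_real t * I"]
      by (simp add: I_def q_def norm_mult power_mult_distrib)
  qed
  show ?thesis
  proof (cases "q = 0")
    case True
    have "cmod I = 0"
    proof (rule ccontr)
      assume "cmod I \<noteq> 0"
      then show False using *[of "(e + 1) / (cmod I)\<^sup>2"] True \<open>0 \<le> e\<close> by simp
    qed
    then show ?thesis using True by (simp add: I_def q_def)
  next
    case False
    then have "0 < q" using L2_sq_nonneg[of M v] by (simp add: q_def)
    then have "(cmod I)\<^sup>2 / q \<le> e" using *[of "1 / q"] by (simp add: power2_eq_square field_simps)
    then show ?thesis using \<open>0 < q\<close> by (simp add: I_def q_def field_simps)
  qed
qed

lemma L2_Cauchy_Schwarz:
  assumes u: "u \<in> L2 M" and v: "v \<in> L2 M"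
  shows "(cmod (L2_inner M u v))\<^sup>2 \<le> L2_sq M u * L2_sq M v"
  using L2_best_approximation_inner_bound[OF u v L2_sq_nonneg[of M u]] L2_sq_nonneg by fastforce

lemma L2_inner_commute: "L2_inner M v u = cnj (L2_inner M u v)"
proof -
  have "cnj (L2_inner M u v) = (\<integral>x. cnj (u x * cnj (v x)) \<partial>M)"
    unfolding L2_inner_def by (simp only: Bochner_Integration.integral_cnj)
  also have "\<dots> = L2_inner M v u"
    unfolding L2_inner_def by (rule Bochner_Integration.integral_cong) (simp_all add: mult.commute)
  finally show ?thesis by simp
qed

lemma L2_inner_diff_left:
  assumes "u \<in> L2 M" "v \<in> L2 M" "w \<in> L2 M"
  shows "L2_inner M (\<lambda>x. u x - v x) w = L2_inner M u w - L2_inner M v w"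
  unfolding L2_inner_def left_diff_distrib
  by (intro Bochner_Integration.integral_diff L2_inner_integrable assms)

lemma L2_inner_diff_right:
  assumes "u \<in> L2 M" "v \<in> L2 M" "w \<in> L2 M"
  shows "L2_inner M w (\<lambda>x. u x - v x) = L2_inner M w u - L2_inner M w v"
  unfolding L2_inner_def complex_cnj_diff right_diff_distrib
  by (intro Bochner_Integration.integral_diff L2_inner_integrable assms)

lemma L2_parallelogram:
  assumes u: "u \<in> L2 M" and v: "v \<in> L2 M"
  shows "L2_sq M (\<lambda>x. u x - v x) = 2 * L2_sq M u + 2 * L2_sq M v - 4 * L2_sq M (\<lambda>x. (u x + v x) / 2)"
proof -
  have "L2_sq M (\<lambda>x. u x - v x) + L2_sq M (\<lambda>x. u x + v x) = 2 * L2_sq M u + 2 * L2_sq M v"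
    using L2_sq_diff_scaled[OF u v, of 1] L2_sq_diff_scaled[OF u v, of "-1"] by simp
  moreover have "L2_sq M (\<lambda>x. (u x + v x) / 2) = L2_sq M (\<lambda>x. u x + v x) / 4"
    using L2_scale(2)[OF L2_add(1)[OF u v], of "1 / 2"] by (simp add: power2_eq_square)
  ultimately show ?thesis by simp
qed

text \<open>
  A sequential form of the statement that a subspace with trivial orthogonal complement is dense. The
  component of \<open>f\<close> orthogonal to \<open>W\<close> is represented by a Cauchy sequence of differences
  \<open>h n = f - g n\<close>, where the \<open>g n\<close> in \<open>W\<close> minimize the distance to \<open>f\<close> in the limit, and
  orthogonality becomes convergence of the inner products to zero. The hypothesis \<open>dual\<close> transfers
  this from \<open>W\<close> to a set \<open>Q\<close> that is known to approximate \<open>f\<close>. With a close approximation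
  \<open>p\<close> in \<open>Q\<close>,
  \<open>L2_sq (h n) = L2_inner p (h n) + L2_inner (f - p) (h n) - L2_inner (g n) (h n)\<close>
  becomes smaller than any positive lower bound for the square of the distance.
\<close>

theorem L2_dense_if_weakly_orthogonal_vanish:
  assumes W: "W \<subseteq> L2 M" "W \<noteq> {}"
    "\<And>u v. u \<in> W \<Longrightarrow> v \<in> W \<Longrightarrow> (\<lambda>x. u x + v x) \<in> W"
    "\<And>c u. u \<in> W \<Longrightarrow> (\<lambda>x. c * u x) \<in> W"
    and f: "f \<in> L2 M" and Q: "Q \<subseteq> L2 M" "\<And>e. 0 < e \<Longrightarrow> \<exists>p\<in>Q. L2_sq M (\<lambda>x. f x - p x) < e"
    and dual: "\<And>h p. \<lbrakk>\<And>n. h n \<in> L2 M;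
        \<And>e. 0 < e \<Longrightarrow> \<exists>N. \<forall>m\<ge>N. \<forall>n\<ge>N. L2_sq M (\<lambda>x. h m x - h n x) < e;
        \<And>s. s \<in> W \<Longrightarrow> (\<lambda>n. L2_inner M s (h n)) \<longlonglongrightarrow> 0; p \<in> Q\<rbrakk>
      \<Longrightarrow> (\<lambda>n. L2_inner M p (h n)) \<longlonglongrightarrow> 0"
    and e: "0 < (e::real)"
  shows "\<exists>g\<in>W. L2_sq M (\<lambda>x. f x - g x) < e"
proof -
  define D where "D = (\<lambda>g. L2_sq M (\<lambda>x. f x - g x)) ` W"
  define d where "d = Inf D"
  have bdd: "bdd_below D" unfolding D_def by (auto intro!: bdd_belowI[of _ 0] L2_sq_nonneg)
  have Dne: "D \<noteq> {}" using W(2) by (simp add: D_def)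
  have dle: "d \<le> L2_sq M (\<lambda>x. f x - g x)" if "g \<in> W" for g
    unfolding d_def by (rule cInf_lower[OF _ bdd]) (use that in \<open>auto simp: D_def\<close>)
  have d0: "0 \<le> d" unfolding d_def by (rule cInf_greatest[OF Dne]) (auto simp: D_def L2_sq_nonneg)
  have "\<exists>g\<in>W. L2_sq M (\<lambda>x. f x - g x) < d + inverse (real (Suc n))" for n
    using cInf_lessD[OF Dne, of "d + inverse (real (Suc n))"] by (auto simp: D_def d_def)
  then obtain g where g: "\<And>n. g n \<in> W" "\<And>n. L2_sq M (\<lambda>x. f x - g n x) < d + inverse (real (Suc n))"
    by metis
  define h where "h n x = f x - g n x" for n x
  have gL: "g n \<in> L2 M" for n using g W by auto
  have hL: "h n \<in> L2 M" for n unfolding h_def using L2_diff(1)[OF f gL] by simp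
  have hsq: "L2_sq M (h n) \<le> d + inverse (real (Suc n))" for n
    using g(2)[of n] unfolding h_def[abs_def] by (rule less_imp_le)
  have dh: "d \<le> L2_sq M (h n)" for n
    using dle[OF g(1)] unfolding h_def[abs_def] .
  have lim: "(\<lambda>n. inverse (real (Suc n))) \<longlonglongrightarrow> 0" by (rule LIMSEQ_inverse_real_of_nat)
  have Cauchy: "\<exists>N. \<forall>m\<ge>N. \<forall>n\<ge>N. L2_sq M (\<lambda>x. h m x - h n x) < e" if e: "0 < e" for e
  proof -
    obtain N where N: "\<And>n. n \<ge> N \<Longrightarrow> inverse (real (Suc n)) < e / 4"
      using order_tendstoD(2)[OF lim, of "e / 4"] e by (auto simp: eventually_sequentially)
    have "L2_sq M (\<lambda>x. h m x - h n x) < e" if "m \<ge> N" "n \<ge> N" for m n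
    proof -
      have mid: "(\<lambda>x. 1 / 2 * (g m x + g n x)) \<in> W" by (intro W(3,4) g)
      have "(\<lambda>x. f x - 1 / 2 * (g m x + g n x)) = (\<lambda>x. (h m x + h n x) / 2)"
        by (simp add: h_def field_simps)
      then have "d \<le> L2_sq M (\<lambda>x. (h m x + h n x) / 2)" using dle[OF mid] by (simp only:)
      then show ?thesis
        using L2_parallelogram[OF hL hL, of m n] hsq[of m] hsq[of n] N[OF that(1)] N[OF that(2)] by linarith
    qed
    then show ?thesis by blast
  qed
  have orth: "(cmod (L2_inner M s (h n)))\<^sup>2 \<le> inverse (real (Suc n)) * L2_sq M s" if s: "s \<in> W" for s n
  proof -
    have "(cmod (L2_inner M (h n) s))\<^sup>2 \<le> inverse (real (Suc n)) * L2_sq M s"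
    proof (rule L2_best_approximation_inner_bound)
      fix c
      have "(\<lambda>x. g n x + c * s x) \<in> W" by (intro W(3,4) g s)
      then have "d \<le> L2_sq M (\<lambda>x. f x - (g n x + c * s x))" by (rule dle)
      then show "L2_sq M (h n) - inverse (real (Suc n)) \<le> L2_sq M (\<lambda>x. h n x - c * s x)"
        using hsq[of n] by (simp add: h_def algebra_simps)
    qed (use s W hL in auto)
    then show ?thesis by (simp add: L2_inner_commute[of M s])
  qed
  have lim0: "(\<lambda>n. L2_inner M s (h n)) \<longlonglongrightarrow> 0" if s: "s \<in> W" for s
  proof -
    have "(\<lambda>n. (cmod (L2_inner M s (h n)))\<^sup>2) \<longlonglongrightarrow> 0"
      by (rule tendsto_sandwich[OF _ _ tendsto_const tendsto_mult_left_zero[OF lim, of "L2_sq M s"]])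
        (use orth[OF s] in auto)
    then have "(\<lambda>n. sqrt ((cmod (L2_inner M s (h n)))\<^sup>2)) \<longlonglongrightarrow> sqrt 0" by (rule tendsto_real_sqrt)
    then show ?thesis by (simp add: tendsto_norm_zero_iff)
  qed
  have limQ: "(\<lambda>n. L2_inner M p (h n)) \<longlonglongrightarrow> 0" if "p \<in> Q" for p
    by (rule dual[OF hL Cauchy lim0 that])
  have bh: "L2_sq M (h n) \<le> d + 1" for n
    using hsq[of n] le_imp_inverse_le[of 1 "real (Suc n)"] by simp
  have "d \<le> 0"
  proof (rule ccontr)
    assume "\<not> d \<le> 0"
    then have d: "0 < d" by simp
    \<comment> \<open>The value makes \<open>sqrt (\<eta> (d + 1))\<close>, which bounds the inner product of \<open>f - p\<close> with
      \<open>h n\<close>, equal to \<open>d / 4\<close>.\<close>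
    define \<eta> where "\<eta> = d\<^sup>2 / (16 * (d + 1))"
    have \<eta>: "0 < \<eta>" using d by (simp add: \<eta>_def)
    obtain p where p: "p \<in> Q" "L2_sq M (\<lambda>x. f x - p x) < \<eta>" using Q(2)[OF \<eta>] by blast
    have pL: "p \<in> L2 M" using p Q by auto
    have fL: "(\<lambda>x. f x - p x) \<in> L2 M" by (rule L2_diff(1)[OF f pL])
    define G where "G = 2 * L2_sq M f + 2 * (d + 1)"
    have gG: "L2_sq M (g n) \<le> G" for n
      using L2_diff(2)[OF f hL, of n] bh[of n] by (simp add: h_def G_def)
    have split: "L2_sq M (h n) \<le> cmod (L2_inner M p (h n)) + d / 4 + sqrt (G * inverse (real (Suc n)))" for n
    proof -
      have "L2_inner M (h n) (h n) = of_real (L2_sq M (h n))"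
        by (simp add: L2_inner_def L2_sq_def complex_norm_square[symmetric] del: of_real_power)
      moreover have "L2_inner M (h n) (h n) = L2_inner M f (h n) - L2_inner M (g n) (h n)"
      proof -
        have "h n = (\<lambda>x. f x - g n x)" by (rule ext) (simp add: h_def)
        then show ?thesis using L2_inner_diff_left[OF f gL hL, of n n] by simp
      qed
      moreover have "L2_inner M (\<lambda>x. f x - p x) (h n) = L2_inner M f (h n) - L2_inner M p (h n)"
        by (rule L2_inner_diff_left[OF f pL hL])
      ultimately have eq: "of_real (L2_sq M (h n)) = L2_inner M p (h n)
          + L2_inner M (\<lambda>x. f x - p x) (h n) - L2_inner M (g n) (h n)" by simp
      have "(cmod (L2_inner M (\<lambda>x. f x - p x) (h n)))\<^sup>2 \<le> \<eta> * (d + 1)"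
        using L2_Cauchy_Schwarz[OF fL hL, of n] p(2) bh[of n] \<eta> d
          mult_mono[of "L2_sq M (\<lambda>x. f x - p x)" \<eta> "L2_sq M (h n)" "d + 1"] L2_sq_nonneg[of M "h n"] by linarith
      also have "\<dots> = (d / 4)\<^sup>2"
      proof -
        have "16 * (d + 1) * \<eta> = d\<^sup>2" using d by (simp add: \<eta>_def)
        then show ?thesis by (simp add: power_divide algebra_simps)
      qed
      finally have 1: "cmod (L2_inner M (\<lambda>x. f x - p x) (h n)) \<le> d / 4"
        by (rule power2_le_imp_le) (use d in auto)
      have "(cmod (L2_inner M (g n) (h n)))\<^sup>2 \<le> inverse (real (Suc n)) * G"
        using orth[OF g(1), of n n] gG[of n] by (meson inverse_nonnegative_iff_nonnegative mult_left_mono of_nat_0_le_iff order_trans)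
      then have 2: "cmod (L2_inner M (g n) (h n)) \<le> sqrt (G * inverse (real (Suc n)))"
        by (intro real_le_rsqrt) (simp add: mult.commute)
      have "L2_sq M (h n) = cmod (of_real (L2_sq M (h n)))" using L2_sq_nonneg[of M "h n"] by simp
      also have "\<dots> \<le> cmod (L2_inner M p (h n) + L2_inner M (\<lambda>x. f x - p x) (h n)) + cmod (L2_inner M (g n) (h n))"
        unfolding eq by (rule norm_triangle_ineq4)
      also have "\<dots> \<le> cmod (L2_inner M p (h n)) + cmod (L2_inner M (\<lambda>x. f x - p x) (h n)) + cmod (L2_inner M (g n) (h n))"
        by (intro add_right_mono norm_triangle_ineq)
      finally show ?thesis using 1 2 by linarith
    qed
    have "(\<lambda>n. cmod (L2_inner M p (h n)) + d / 4 + sqrt (G * inverse (real (Suc n)))) \<longlonglongrightarrow> 0 + d / 4 + sqrt (G * 0)"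
      by (intro tendsto_intros limQ[OF p(1), THEN tendsto_norm_zero] lim)
    moreover have "d \<le> cmod (L2_inner M p (h n)) + d / 4 + sqrt (G * inverse (real (Suc n)))" for n
      using split[of n] dh[of n] by linarith
    ultimately have "d \<le> 0 + d / 4 + sqrt (G * 0)"
      by (intro LIMSEQ_le_const) auto
    then show False using d by simp
  qed
  then obtain n where "d + inverse (real (Suc n)) < e"
    using order_tendstoD(2)[OF lim e] by (auto simp: eventually_sequentially) (smt (verit) order_refl)
  then show ?thesis using g[of n] by force
qed

section \<open>Powers in the Bergman space of the disc\<close>

abbreviation disc_lborel :: "complex measure" where
  "disc_lborel \<equiv> restrict_space lborel Delta"

lemma space_disc_lborel: "space disc_lborel = Delta"
  by (simp add: space_restrict_space)

lemma Delta_props: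
  assumes "\<zeta> \<in> Delta"
  shows "0 < Re \<zeta>" "\<zeta> \<noteq> 0" "\<zeta> \<notin> \<real>\<^sub>\<le>\<^sub>0" "cmod \<zeta> < 2" "\<bar>Im (Ln \<zeta>)\<bar> < pi / 2" "Re (Ln \<zeta>) = ln (cmod \<zeta>)"
proof -
  have d: "cmod (\<zeta> - 1) < 1" using assms by (simp add: Delta_def dist_norm norm_minus_commute)
  then show re: "0 < Re \<zeta>" using abs_Re_le_cmod[of "\<zeta> - 1"] by simp
  then show nz: "\<zeta> \<noteq> 0" by auto
  show "\<zeta> \<notin> \<real>\<^sub>\<le>\<^sub>0" using re by (auto simp: complex_nonpos_Reals_iff)
  show "cmod \<zeta> < 2" using norm_triangle_sub[of \<zeta> 1] d by simp
  show "\<bar>Im (Ln \<zeta>)\<bar> < pi / 2" using Re_Ln_pos_lt[OF nz] re by simp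
  show "Re (Ln \<zeta>) = ln (cmod \<zeta>)" using nz by simp
qed

lemma continuous_on_Delta_measurable:
  "continuous_on Delta f \<Longrightarrow> f \<in> borel_measurable disc_lborel"
  for f :: "complex \<Rightarrow> 'b::topological_space"
  by (drule borel_measurable_continuous_on_restrict)
    (simp cong: measurable_cong_sets sets_restrict_space_cong)

lemma exists_dyadic_bracket:
  fixes t :: real
  assumes "0 < t" "t < 2"
  shows "\<exists>k. 1 / 2 ^ k \<le> t \<and> t < 2 / 2 ^ k"
proof -
  have ex: "\<exists>k. 1 / 2 ^ k \<le> t"
    using real_arch_pow_inv[of t "1 / 2"] assms by (auto simp: power_divide intro: less_imp_le)
  define k where "k = (LEAST k. 1 / 2 ^ k \<le> t)"
  have k: "1 / 2 ^ k \<le> t" unfolding k_def by (rule LeastI_ex[OF ex])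
  have "t < 2 / 2 ^ k"
  proof (cases k)
    case 0 then show ?thesis using assms by simp
  next
    case (Suc j)
    then have "\<not> 1 / 2 ^ j \<le> t" using not_less_Least[of j "\<lambda>k. 1 / 2 ^ k \<le> t"] by (simp add: k_def)
    then show ?thesis using Suc by simp
  qed
  then show ?thesis using k by blast
qed

lemma ennreal_term_le_suminf: "F k \<le> suminf F" for F :: "nat \<Rightarrow> ennreal"
  using sum_le_suminf[of F "{k}"] by simp

text \<open>
  The disc touches the origin, where the integrand may be singular. On the dyadic annulus
  \<open>2\<^sup>-\<^sup>k \<le> |\<zeta>| < 2\<^sup>1\<^sup>-\<^sup>k\<close> the integrand is at most its value on the inner circle, and the areas
  decrease like \<open>4\<^sup>-\<^sup>k\<close>, which leaves the geometric series with ratio \<open>2\<^sup>-\<^sup>2\<^sup>\<delta>\<close>.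
\<close>

lemma integrable_norm_powr_disc:
  assumes \<delta>: "0 < \<delta>" "\<delta> \<le> 1"
  shows "integrable disc_lborel (\<lambda>\<zeta>. cmod \<zeta> powr (2 * \<delta> - 2))"
proof (rule integrableI_bounded)
  let ?f = "\<lambda>\<zeta>::complex. cmod \<zeta> powr (2 * \<delta> - 2)"
  show "?f \<in> borel_measurable disc_lborel"
    by (rule continuous_on_Delta_measurable) (auto intro!: continuous_intros simp: Delta_props)
  define c where "c k = (1 / 2 ^ k) powr (2 * \<delta> - 2)" for k :: nat
  define q where "q = 2 powr (- (2 * \<delta>))"
  have q: "0 \<le> q" "q < 1" using \<delta> powr_less_mono[of "- (2 * \<delta>)" 0 2] by (auto simp: q_def)
  have "(\<integral>\<^sup>+ \<zeta>. ennreal (norm (?f \<zeta>)) \<partial>disc_lborel)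
      = (\<integral>\<^sup>+ \<zeta>. ennreal (norm (?f \<zeta>)) * indicator Delta \<zeta> \<partial>lborel)"
    by (rule nn_integral_restrict_space) (simp add: Delta_def)
  also have "\<dots> \<le> (\<integral>\<^sup>+ (\<zeta>::complex). (\<Sum>k. ennreal (c k) * indicator (ball 0 (2 / 2 ^ k)) \<zeta>) \<partial>lborel)"
  proof (rule nn_integral_mono)
    fix \<zeta> :: complex
    show "ennreal (norm (?f \<zeta>)) * indicator Delta \<zeta> \<le> (\<Sum>k. ennreal (c k) * indicator (ball 0 (2 / 2 ^ k)) \<zeta>)"
    proof (cases "\<zeta> \<in> Delta")
      case True
      obtain k where k: "1 / 2 ^ k \<le> cmod \<zeta>" "cmod \<zeta> < 2 / 2 ^ k"
        using exists_dyadic_bracket[of "cmod \<zeta>"] Delta_props[OF True] by auto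
      have "?f \<zeta> \<le> c k" unfolding c_def
        using k \<delta> by (intro powr_mono2') auto
      then have "ennreal (norm (?f \<zeta>)) * indicator Delta \<zeta> \<le> ennreal (c k) * indicator (ball 0 (2 / 2 ^ k)) \<zeta>"
        using k True by (simp add: ennreal_leI)
      also have "\<dots> \<le> (\<Sum>k. ennreal (c k) * indicator (ball 0 (2 / 2 ^ k)) \<zeta>)"
        by (rule ennreal_term_le_suminf)
      finally show ?thesis .
    qed simp
  qed
  also have "\<dots> = (\<Sum>k. \<integral>\<^sup>+ \<zeta>. ennreal (c k) * indicator (ball (0::complex) (2 / 2 ^ k)) \<zeta> \<partial>lborel)"
    by (rule nn_integral_suminf) (auto intro!: borel_measurable_times_ennreal borel_measurable_indicator)
  also have "\<dots> = (\<Sum>k. ennreal (4 * pi * q ^ k))"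
  proof (rule suminf_cong)
    fix k
    have "(\<integral>\<^sup>+ \<zeta>. ennreal (c k) * indicator (ball (0::complex) (2 / 2 ^ k)) \<zeta> \<partial>lborel)
        = ennreal (c k) * emeasure lborel (ball (0::complex) (2 / 2 ^ k))"
      by (subst nn_integral_cmult_indicator) auto
    also have "emeasure lborel (ball (0::complex) (2 / 2 ^ k)) = ennreal (pi * (2 / 2 ^ k)\<^sup>2)"
      by (subst emeasure_ball) (auto simp: unit_ball_vol_2)
    also have "ennreal (c k) * \<dots> = ennreal (c k * (pi * (2 / 2 ^ k)\<^sup>2))"
      by (rule ennreal_mult[symmetric]) (auto simp: c_def)
    also have "c k * (pi * (2 / 2 ^ k)\<^sup>2) = 4 * pi * q ^ k"
    proof -
      have t: "1 / 2 ^ k = 2 powr (- real k)" by (simp add: powr_minus powr_realpow divide_inverse)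
      have "c k * (1 / 2 ^ k)\<^sup>2 = 2 powr (- real k * (2 * \<delta> - 2)) * (2 powr (- real k))\<^sup>2"
        unfolding c_def t by (simp add: powr_powr)
      also have "\<dots> = 2 powr (- real k * (2 * \<delta> - 2) + - real k + - real k)"
        by (simp only: powr_add power2_eq_square mult.assoc)
      also have "\<dots> = q powr real k" unfolding q_def powr_powr by (simp add: algebra_simps)
      also have "\<dots> = q ^ k" by (rule powr_realpow) (simp add: q_def)
      finally have "c k * (1 / 2 ^ k)\<^sup>2 = q ^ k" .
      moreover have "c k * (pi * (2 / 2 ^ k)\<^sup>2) = 4 * pi * (c k * (1 / 2 ^ k)\<^sup>2)"
        by (simp add: power_divide)
      ultimately show ?thesis by simp
    qed
    finally show "(\<integral>\<^sup>+ \<zeta>. ennreal (c k) * indicator (ball (0::complex) (2 / 2 ^ k)) \<zeta> \<partial>lborel) = ennreal (4 * pi * q ^ k)" .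
  qed
  also have "\<dots> < \<infinity>"
    using q by (subst suminf_ennreal2) (auto intro!: summable_mult summable_geometric)
  finally show "(\<integral>\<^sup>+ \<zeta>. ennreal (norm (?f \<zeta>)) \<partial>disc_lborel) < \<infinity>" .
qed

lemma norm_powr_Delta:
  assumes "\<zeta> \<in> Delta"
  shows "cmod (\<zeta> powr (w - 1)) = cmod \<zeta> powr (Re w - 1) * exp (- (Im w * Im (Ln \<zeta>)))"
proof -
  have "cmod (\<zeta> powr (w - 1)) = exp (Re ((w - 1) * Ln \<zeta>))"
    using Delta_props[OF assms] by (simp add: powr_def norm_exp_eq_Re)
  also have "Re ((w - 1) * Ln \<zeta>) = (Re w - 1) * ln (cmod \<zeta>) + - (Im w * Im (Ln \<zeta>))"
    using Delta_props[OF assms] by simp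
  finally show ?thesis using Delta_props[OF assms] by (simp add: powr_def flip: exp_add)
qed

lemma norm_powr_Delta_square_le:
  assumes \<zeta>: "\<zeta> \<in> Delta" and \<delta>: "0 < \<delta>" "\<delta> \<le> Re w"
  shows "(cmod (\<zeta> powr (w - 1)))\<^sup>2 \<le> exp (pi * \<bar>Im w\<bar>) * 4 powr Re w * cmod \<zeta> powr (2 * \<delta> - 2)"
proof -
  note p = Delta_props[OF \<zeta>]
  have "- (Im w * Im (Ln \<zeta>)) \<le> \<bar>Im w\<bar> * \<bar>Im (Ln \<zeta>)\<bar>"
    by (metis abs_ge_minus_self abs_mult)
  also have "\<dots> \<le> \<bar>Im w\<bar> * (pi / 2)" using p by (intro mult_left_mono) auto
  finally have "2 * (- (Im w * Im (Ln \<zeta>))) \<le> pi * \<bar>Im w\<bar>" by (simp add: algebra_simps)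
  then have a: "(exp (- (Im w * Im (Ln \<zeta>))))\<^sup>2 \<le> exp (pi * \<bar>Im w\<bar>)"
    unfolding exp_double[symmetric] exp_le_cancel_iff .
  have "(cmod \<zeta> powr (Re w - 1))\<^sup>2 = cmod \<zeta> powr (2 * (Re w - \<delta>)) * cmod \<zeta> powr (2 * \<delta> - 2)"
    by (simp add: power2_eq_square flip: powr_add)
  also have "\<dots> \<le> 4 powr Re w * cmod \<zeta> powr (2 * \<delta> - 2)"
  proof (intro mult_right_mono)
    have "cmod \<zeta> powr (2 * (Re w - \<delta>)) \<le> 2 powr (2 * (Re w - \<delta>))"
      using p \<delta> by (intro powr_mono2) auto
    also have "\<dots> \<le> 2 powr (2 * Re w)" using \<delta> by (intro powr_mono) auto
    also have "\<dots> = (2 powr 2) powr Re w" by (simp only: powr_powr)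
    finally show "cmod \<zeta> powr (2 * (Re w - \<delta>)) \<le> 4 powr Re w" by simp
  qed auto
  finally have b: "(cmod \<zeta> powr (Re w - 1))\<^sup>2 \<le> 4 powr Re w * cmod \<zeta> powr (2 * \<delta> - 2)" .
  have "(cmod (\<zeta> powr (w - 1)))\<^sup>2 = (exp (- (Im w * Im (Ln \<zeta>))))\<^sup>2 * (cmod \<zeta> powr (Re w - 1))\<^sup>2"
    by (simp add: norm_powr_Delta[OF \<zeta>] power_mult_distrib)
  also have "\<dots> \<le> exp (pi * \<bar>Im w\<bar>) * (4 powr Re w * cmod \<zeta> powr (2 * \<delta> - 2))"
    using a b by (intro mult_mono) auto
  finally show ?thesis by (simp add: mult_ac)
qed

lemma continuous_on_Delta_powr: "continuous_on Delta (\<lambda>\<zeta>. \<zeta> powr (w - 1))"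
  by (intro holomorphic_on_imp_continuous_on holomorphic_intros) (use Delta_props in auto)

text \<open>
  The point is the dependence on \<open>w\<close>: the argument of \<open>\<zeta>\<close> stays in \<open>(-\<pi>/2, \<pi>/2)\<close> and
  \<open>|\<zeta>| < 2\<close>, so the norm of the power grows at most like \<open>e\<^sup>\<pi>\<^sup>|\<^sup>y\<^sup>|\<^sup>/\<^sup>2 2\<^sup>x\<close>, uniformly in
  \<open>x \<ge> \<delta>\<close>.
\<close>

lemma powr_in_L2_disc:
  assumes \<delta>: "0 < \<delta>"
  shows "\<exists>A. 0 \<le> A \<and> (\<forall>w. \<delta> \<le> Re w \<longrightarrow> (\<lambda>\<zeta>. \<zeta> powr (w - 1)) \<in> L2 disc_lborel \<and>
    L2_sq disc_lborel (\<lambda>\<zeta>. \<zeta> powr (w - 1)) \<le> A * exp (pi * \<bar>Im w\<bar>) * 4 powr Re w)"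
proof -
  define \<delta>' where "\<delta>' = min \<delta> 1"
  have \<delta>': "0 < \<delta>'" "\<delta>' \<le> 1" "\<delta>' \<le> \<delta>" using \<delta> by (auto simp: \<delta>'_def)
  define A where "A = (\<integral>\<zeta>. cmod \<zeta> powr (2 * \<delta>' - 2) \<partial>disc_lborel)"
  note int = integrable_norm_powr_disc[OF \<delta>'(1,2)]
  show ?thesis
  proof (intro exI[of _ A] conjI allI impI)
    show "0 \<le> A" by (simp add: A_def)
    fix w assume w: "\<delta> \<le> Re w"
    let ?g = "\<lambda>\<zeta>. exp (pi * \<bar>Im w\<bar>) * 4 powr Re w * cmod \<zeta> powr (2 * \<delta>' - 2)"
    have g: "integrable disc_lborel ?g" using int by simp
    have m: "(\<lambda>\<zeta>. \<zeta> powr (w - 1)) \<in> borel_measurable disc_lborel"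
      by (intro continuous_on_Delta_measurable continuous_on_Delta_powr)
    have le: "(cmod (\<zeta> powr (w - 1)))\<^sup>2 \<le> ?g \<zeta>" if "\<zeta> \<in> space disc_lborel" for \<zeta>
      using norm_powr_Delta_square_le[of \<zeta> \<delta>' w] that \<delta>' w by (simp add: space_disc_lborel)
    show "(\<lambda>\<zeta>. \<zeta> powr (w - 1)) \<in> L2 disc_lborel" by (rule L2_I_le(1)[OF m g le])
    show "L2_sq disc_lborel (\<lambda>\<zeta>. \<zeta> powr (w - 1)) \<le> A * exp (pi * \<bar>Im w\<bar>) * 4 powr Re w"
      using L2_I_le(2)[OF m g le] by (simp add: A_def mult_ac)
  qed
qed

lemma exp_norm_Ln_le:
  assumes \<zeta>: "\<zeta> \<in> Delta" and r: "0 \<le> r"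
  shows "exp (r * cmod (Ln \<zeta>)) \<le> exp (r * (pi / 2)) * 4 powr r * cmod \<zeta> powr (- r)"
proof -
  note p = Delta_props[OF \<zeta>]
  have "cmod (Ln \<zeta>) \<le> \<bar>ln (cmod \<zeta>)\<bar> + pi / 2"
    using cmod_le[of "Ln \<zeta>"] p by simp
  moreover have "\<bar>ln (cmod \<zeta>)\<bar> \<le> ln 4 - ln (cmod \<zeta>)"
  proof (cases "cmod \<zeta> \<le> 1")
    case True
    then show ?thesis using p by (simp add: abs_of_nonpos)
  next
    case False
    have "2 * ln (cmod \<zeta>) = ln ((cmod \<zeta>)\<^sup>2)" using p by (simp add: ln_realpow)
    also have "\<dots> \<le> ln 4"
      using p power_mono[of "cmod \<zeta>" 2 2] by (subst ln_le_cancel_iff) auto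
    finally show ?thesis using False by simp
  qed
  ultimately have "r * cmod (Ln \<zeta>) \<le> r * (pi / 2 + ln 4 - ln (cmod \<zeta>))"
    using r by (intro mult_left_mono) auto
  then have "exp (r * cmod (Ln \<zeta>)) \<le> exp (r * (pi / 2) + r * ln 4 + (- r) * ln (cmod \<zeta>))"
    by (simp add: algebra_simps)
  also have "\<dots> = exp (r * (pi / 2)) * 4 powr r * cmod \<zeta> powr (- r)"
    using p by (simp only: exp_add powr_def) simp
  finally show ?thesis .
qed

lemma open_right_half_plane: "open right_half_plane"
  by (simp add: right_half_plane_def open_halfspace_Re_gt)

text \<open>
  Around \<open>w0\<close> the kernel has the expansion
  \<open>\<zeta>\<^sup>w\<^sup>-\<^sup>1 = (\<Sum>n. (w - w0)\<^sup>n (log \<zeta>)\<^sup>n / n!) \<zeta>\<^sup>w\<^sup>0\<^sup>-\<^sup>1\<close>, and integrating it term by term gives a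
  power series for the transform. On the disc of radius \<open>r = \<Re>w0 / 2\<close> the sum of the absolute values
  is at most a multiple of \<open>|\<zeta>|\<^sup>r\<^sup>-\<^sup>1\<close>, because \<open>exp (r |log \<zeta>|)\<close> costs only a factor
  \<open>|\<zeta>|\<^sup>-\<^sup>r\<close>; that power is still square integrable.
\<close>

lemma holomorphic_powr_transform:
  assumes v: "v \<in> L2 disc_lborel"
  shows "(\<lambda>w. L2_inner disc_lborel (\<lambda>\<zeta>. \<zeta> powr (w - 1)) v) holomorphic_on right_half_plane"
proof -
  let ?F = "\<lambda>w. L2_inner disc_lborel (\<lambda>\<zeta>. \<zeta> powr (w - 1)) v"
  have "\<exists>f'. (?F has_field_derivative f') (at w0)" if w0: "w0 \<in> right_half_plane" for w0
  proof -
    define r where "r = Re w0 / 2"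
    have r: "0 < r" "Re w0 - r = r" using w0 by (auto simp: right_half_plane_def r_def)
    define k0 where "k0 \<zeta> = \<zeta> powr (w0 - 1) * cnj (v \<zeta>)" for \<zeta>
    define k1 where "k1 \<zeta> = \<zeta> powr (of_real r - 1) * cnj (v \<zeta>)" for \<zeta>
    define B where "B = exp (r * (pi / 2)) * 4 powr r * exp (\<bar>Im w0\<bar> * (pi / 2))"
    define a where "a n = (\<integral>\<zeta>. (Ln \<zeta>) ^ n / fact n * k0 \<zeta> \<partial>disc_lborel)" for n
    have L2w: "(\<lambda>\<zeta>. \<zeta> powr (w - 1)) \<in> L2 disc_lborel" if "0 < Re w" for w
      using powr_in_L2_disc[OF that] by auto
    have ik1: "integrable disc_lborel (\<lambda>\<zeta>. B * cmod (k1 \<zeta>))"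
      unfolding k1_def using L2_inner_integrable[OF L2w v, of "of_real r"] r by (intro integrable_mult_right integrable_norm) auto
    have mk0: "k0 \<in> borel_measurable disc_lborel"
      unfolding k0_def using L2_inner_integrable[OF L2w v, of w0] w0 by (auto simp: right_half_plane_def)
    have mLn: "Ln \<in> borel_measurable disc_lborel"
      by (intro continuous_on_Delta_measurable continuous_intros) (use Delta_props in auto)
    have dom: "exp (r * cmod (Ln \<zeta>)) * cmod (k0 \<zeta>) \<le> B * cmod (k1 \<zeta>)" if \<zeta>: "\<zeta> \<in> Delta" for \<zeta>
    proof -
      note p = Delta_props[OF \<zeta>]
      have "- (Im w0 * Im (Ln \<zeta>)) \<le> \<bar>Im w0\<bar> * \<bar>Im (Ln \<zeta>)\<bar>"
        by (metis abs_ge_minus_self abs_mult)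
      also have "\<dots> \<le> \<bar>Im w0\<bar> * (pi / 2)" using p by (intro mult_left_mono) auto
      finally have "cmod (\<zeta> powr (w0 - 1)) \<le> cmod \<zeta> powr (Re w0 - 1) * exp (\<bar>Im w0\<bar> * (pi / 2))"
        by (simp add: norm_powr_Delta[OF \<zeta>] mult_left_mono)
      then have "exp (r * cmod (Ln \<zeta>)) * cmod (\<zeta> powr (w0 - 1))
          \<le> (exp (r * (pi / 2)) * 4 powr r * cmod \<zeta> powr (- r)) * (cmod \<zeta> powr (Re w0 - 1) * exp (\<bar>Im w0\<bar> * (pi / 2)))"
        using exp_norm_Ln_le[OF \<zeta>, of r] r by (intro mult_mono) auto
      also have "\<dots> = B * (cmod \<zeta> powr (- r) * cmod \<zeta> powr (Re w0 - 1))"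
        by (simp add: B_def mult_ac)
      also have "cmod \<zeta> powr (- r) * cmod \<zeta> powr (Re w0 - 1) = cmod \<zeta> powr (r - 1)"
        using r by (simp flip: powr_add)
      also have "\<dots> = cmod (\<zeta> powr (of_real r - 1))"
        using norm_powr_Delta[OF \<zeta>, of "of_real r"] by simp
      finally have "exp (r * cmod (Ln \<zeta>)) * cmod (\<zeta> powr (w0 - 1)) * cmod (v \<zeta>)
          \<le> B * cmod (\<zeta> powr (of_real r - 1)) * cmod (v \<zeta>)" by (rule mult_right_mono) simp
      then show ?thesis by (simp add: k0_def k1_def norm_mult mult_ac)
    qed
    have sums: "(\<lambda>n. a n * (w - w0) ^ n) sums ?F w" if w: "w \<in> ball w0 r" for w
    proof -
      define f where "f n \<zeta> = ((w - w0) * Ln \<zeta>) ^ n / fact n * k0 \<zeta>" for n \<zeta>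
      have wr: "cmod (w - w0) \<le> r" using w by (simp add: dist_norm norm_minus_commute)
      have mf: "f n \<in> borel_measurable disc_lborel" for n
        unfolding f_def using mLn mk0 by measurable
      have nf: "norm (f n \<zeta>) = (cmod ((w - w0) * Ln \<zeta>)) ^ n / fact n * cmod (k0 \<zeta>)" for n \<zeta>
        by (simp add: f_def norm_mult norm_divide norm_power power_mult_distrib)
      have expsum: "(\<lambda>n. (cmod ((w - w0) * Ln \<zeta>)) ^ n / fact n) sums exp (cmod ((w - w0) * Ln \<zeta>))" for \<zeta>
        using exp_converges[of "cmod ((w - w0) * Ln \<zeta>)"] by (simp add: scaleR_conv_of_real field_simps)
      have psum: "(\<Sum>n<N. norm (f n \<zeta>)) \<le> B * cmod (k1 \<zeta>)" if "\<zeta> \<in> Delta" for \<zeta> N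
      proof -
        have "(\<Sum>n<N. norm (f n \<zeta>)) = (\<Sum>n<N. (cmod ((w - w0) * Ln \<zeta>)) ^ n / fact n) * cmod (k0 \<zeta>)"
          by (simp add: nf sum_distrib_right)
        also have "\<dots> \<le> exp (cmod ((w - w0) * Ln \<zeta>)) * cmod (k0 \<zeta>)"
          using sum_le_suminf[OF sums_summable[OF expsum[of \<zeta>]], of "{..<N}"] sums_unique[OF expsum[of \<zeta>]]
          by (intro mult_right_mono) auto
        also have "\<dots> \<le> exp (r * cmod (Ln \<zeta>)) * cmod (k0 \<zeta>)"
          using wr by (intro mult_right_mono) (auto simp: norm_mult intro: mult_right_mono)
        also have "\<dots> \<le> B * cmod (k1 \<zeta>)" by (rule dom[OF that])
        finally show ?thesis .
      qed
      have if': "integrable disc_lborel (f n)" for n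
      proof (rule Bochner_Integration.integrable_bound[OF ik1 mf AE_I2])
        fix \<zeta> assume "\<zeta> \<in> space disc_lborel"
        then have \<zeta>: "\<zeta> \<in> Delta" by (simp add: space_disc_lborel)
        have "norm (f n \<zeta>) \<le> (\<Sum>i<Suc n. norm (f i \<zeta>))" by (simp add: sum_nonneg)
        then show "norm (f n \<zeta>) \<le> norm (B * cmod (k1 \<zeta>))" using psum[OF \<zeta>, of "Suc n"] by auto
      qed
      have "(\<lambda>n. integral\<^sup>L disc_lborel (f n)) sums (\<integral>\<zeta>. (\<Sum>n. f n \<zeta>) \<partial>disc_lborel)"
      proof (rule sums_integral[OF if'])
        show "AE \<zeta> in disc_lborel. summable (\<lambda>n. norm (f n \<zeta>))"
          unfolding nf by (intro AE_I2 summable_mult2 sums_summable[OF expsum])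
        show "summable (\<lambda>n. \<integral>\<zeta>. norm (f n \<zeta>) \<partial>disc_lborel)"
        proof (rule summableI_nonneg_bounded)
          fix N
          have "(\<Sum>n<N. \<integral>\<zeta>. norm (f n \<zeta>) \<partial>disc_lborel) = (\<integral>\<zeta>. (\<Sum>n<N. norm (f n \<zeta>)) \<partial>disc_lborel)"
            using if' by (subst Bochner_Integration.integral_sum) auto
          also have "\<dots> \<le> (\<integral>\<zeta>. B * cmod (k1 \<zeta>) \<partial>disc_lborel)"
            using if' ik1 psum by (intro integral_mono) (auto simp: space_disc_lborel)
          finally show "(\<Sum>n<N. \<integral>\<zeta>. norm (f n \<zeta>) \<partial>disc_lborel) \<le> (\<integral>\<zeta>. B * cmod (k1 \<zeta>) \<partial>disc_lborel)" .
        qed simp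
      qed
      moreover have "integral\<^sup>L disc_lborel (f n) = a n * (w - w0) ^ n" for n
      proof -
        have "f n = (\<lambda>\<zeta>. (w - w0) ^ n * ((Ln \<zeta>) ^ n / fact n * k0 \<zeta>))"
          by (rule ext) (simp add: f_def power_mult_distrib)
        then show ?thesis unfolding a_def by (simp only: integral_mult_right_zero mult.commute)
      qed
      moreover have "(\<integral>\<zeta>. (\<Sum>n. f n \<zeta>) \<partial>disc_lborel) = ?F w"
        unfolding L2_inner_def
      proof (rule Bochner_Integration.integral_cong[OF refl])
        fix \<zeta> assume "\<zeta> \<in> space disc_lborel"
        then have \<zeta>: "\<zeta> \<in> Delta" by (simp add: space_disc_lborel)
        have "(\<lambda>n. ((w - w0) * Ln \<zeta>) ^ n / fact n) sums exp ((w - w0) * Ln \<zeta>)"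
          using exp_converges[of "(w - w0) * Ln \<zeta>"] by (simp add: scaleR_conv_of_real field_simps)
        then have "(\<lambda>n. f n \<zeta>) sums (exp ((w - w0) * Ln \<zeta>) * k0 \<zeta>)"
          unfolding f_def by (rule sums_mult2)
        moreover have "exp ((w - w0) * Ln \<zeta>) * k0 \<zeta> = \<zeta> powr (w - 1) * cnj (v \<zeta>)"
          using Delta_props[OF \<zeta>] by (simp add: k0_def powr_def algebra_simps flip: exp_add)
        ultimately show "(\<Sum>n. f n \<zeta>) = \<zeta> powr (w - 1) * cnj (v \<zeta>)" by (simp add: sums_iff)
      qed
      ultimately show ?thesis by simp
    qed
    have "?F holomorphic_on ball w0 r" by (rule power_series_holomorphic[OF sums])
    then have "?F field_differentiable at w0"
      using r by (intro holomorphic_on_imp_differentiable_at[of _ "ball w0 r"]) auto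
    then show ?thesis by (simp add: field_differentiable_def)
  qed
  then show ?thesis by (simp add: holomorphic_on_open[OF open_right_half_plane])
qed

section \<open>Density of the polynomials in the Bergman space\<close>

lemma nn_integral_lborel_affine:
  fixes \<phi> :: "'a::euclidean_space \<Rightarrow> ennreal"
  assumes [measurable]: "\<phi> \<in> borel_measurable borel" and "c \<noteq> 0"
  shows "(\<integral>\<^sup>+ x. \<phi> x \<partial>lborel) = ennreal (\<bar>c\<bar> ^ DIM('a)) * (\<integral>\<^sup>+ x. \<phi> (t + c *\<^sub>R x) \<partial>lborel)"
  by (subst lborel_affine[OF assms(2), of t])
    (simp add: nn_integral_density nn_integral_distr nn_integral_cmult)

lemma sets_Delta_lborel: "Delta \<inter> space lborel \<in> sets lborel"
  by (simp add: Delta_def)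

lemma nn_integral_disc_dilation_le:
  fixes f :: "complex \<Rightarrow> complex" and r :: real
  assumes f: "continuous_on Delta f" and r: "0 < r" "r < 1"
  shows "(\<integral>\<^sup>+ \<zeta>. ennreal ((cmod (f (1 + of_real r * (\<zeta> - 1))))\<^sup>2) \<partial>disc_lborel)
    \<le> ennreal (1 / r\<^sup>2) * (\<integral>\<^sup>+ \<zeta>. ennreal ((cmod (f \<zeta>))\<^sup>2) \<partial>disc_lborel)"
proof -
  define \<phi> where "\<phi> \<zeta> = ennreal (indicator (ball 1 r) \<zeta> *\<^sub>R (cmod (f \<zeta>))\<^sup>2)" for \<zeta>
  have sub: "ball 1 r \<subseteq> Delta" using r by (auto simp: Delta_def)
  have "(\<lambda>\<zeta>. indicator (ball 1 r) \<zeta> *\<^sub>R (cmod (f \<zeta>))\<^sup>2) \<in> borel_measurable borel"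
    by (intro borel_measurable_continuous_on_indicator continuous_intros continuous_on_subset[OF f sub]) auto
  then have m: "\<phi> \<in> borel_measurable borel" unfolding \<phi>_def by measurable
  have "(\<integral>\<^sup>+ \<zeta>. ennreal ((cmod (f (1 + of_real r * (\<zeta> - 1))))\<^sup>2) \<partial>disc_lborel)
      = (\<integral>\<^sup>+ \<zeta>. \<phi> (of_real (1 - r) + r *\<^sub>R \<zeta>) \<partial>lborel)"
    unfolding nn_integral_restrict_space[OF sets_Delta_lborel]
  proof (rule nn_integral_cong)
    fix \<zeta> :: complex
    have e: "of_real (1 - r) + r *\<^sub>R \<zeta> = 1 + of_real r * (\<zeta> - 1)"
      by (simp add: scaleR_conv_of_real algebra_simps)
    have "1 + of_real r * (\<zeta> - 1) \<in> ball 1 r \<longleftrightarrow> \<zeta> \<in> Delta"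
      using r by (simp add: Delta_def dist_norm norm_mult norm_minus_commute)
    then show "ennreal ((cmod (f (1 + of_real r * (\<zeta> - 1))))\<^sup>2) * indicator Delta \<zeta>
        = \<phi> (of_real (1 - r) + r *\<^sub>R \<zeta>)"
      unfolding \<phi>_def e by (auto split: split_indicator)
  qed
  also have "\<dots> = ennreal (1 / r\<^sup>2) * (ennreal (\<bar>r\<bar> ^ DIM(complex)) * (\<integral>\<^sup>+ \<zeta>. \<phi> (of_real (1 - r) + r *\<^sub>R \<zeta>) \<partial>lborel))"
    using r by (subst mult.assoc[symmetric], subst ennreal_mult[symmetric]) auto
  also have "\<dots> = ennreal (1 / r\<^sup>2) * (\<integral>\<^sup>+ \<zeta>. \<phi> \<zeta> \<partial>lborel)"
    using r by (subst nn_integral_lborel_affine[OF m, of r "of_real (1 - r)"]) auto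
  also have "\<dots> \<le> ennreal (1 / r\<^sup>2) * (\<integral>\<^sup>+ \<zeta>. ennreal ((cmod (f \<zeta>))\<^sup>2) \<partial>disc_lborel)"
    unfolding nn_integral_restrict_space[OF sets_Delta_lborel]
    using sub by (intro mult_left_mono nn_integral_mono) (auto simp: \<phi>_def split: split_indicator)
  finally show ?thesis .
qed

text \<open>
  The dilated functions \<open>F n\<close> converge to \<open>f\<close> pointwise, and their norms are asymptotically at
  most the norm of \<open>f\<close>. Fatou's lemma for
  \<open>2 |f|\<^sup>2 + 2 |F n|\<^sup>2 - |f - F n|\<^sup>2\<close>, which is nonnegative and tends to \<open>4 |f|\<^sup>2\<close>, then
  excludes that the distances stay above some \<open>e > 0\<close>.
\<close>

lemma L2_disc_dilation_approx:
  assumes hol: "f holomorphic_on Delta" and f: "f \<in> L2 disc_lborel" and e: "0 < e"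
  shows "\<exists>r. 0 < r \<and> r < 1 \<and> (\<lambda>\<zeta>. f (1 + of_real r * (\<zeta> - 1))) \<in> L2 disc_lborel \<and>
    L2_sq disc_lborel (\<lambda>\<zeta>. f \<zeta> - f (1 + of_real r * (\<zeta> - 1))) < e"
proof (rule ccontr)
  assume contra: "\<not> ?thesis"
  define r where "r n = real (Suc n) / real (Suc (Suc n))" for n
  have r: "0 < r n" "r n < 1" for n by (auto simp: r_def)
  have rlim: "r \<longlonglongrightarrow> 1" unfolding r_def[abs_def] by (rule LIMSEQ_Suc[OF LIMSEQ_n_over_Suc_n])
  define F where "F n \<zeta> = f (1 + of_real (r n) * (\<zeta> - 1))" for n \<zeta>
  have contf: "continuous_on Delta f" by (rule holomorphic_on_imp_continuous_on[OF hol])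
  have dil: "1 + of_real (r n) * (\<zeta> - 1) \<in> Delta" if "\<zeta> \<in> Delta" for n \<zeta>
  proof -
    have "cmod (of_real (r n) * (\<zeta> - 1)) \<le> 1 * cmod (\<zeta> - 1)"
      unfolding norm_mult using r[of n] by (intro mult_right_mono) auto
    then show ?thesis using that by (simp add: Delta_def dist_norm norm_minus_commute)
  qed
  have contF: "continuous_on Delta (F n)" for n
    unfolding F_def by (rule continuous_on_compose2[OF contf]) (auto intro!: continuous_intros dil)
  have mF: "F n \<in> borel_measurable disc_lborel" for n
    by (rule continuous_on_Delta_measurable[OF contF])
  define L where "L = L2_sq disc_lborel f"
  have L0: "0 \<le> L" by (simp add: L_def L2_sq_nonneg)
  have nf: "(\<integral>\<^sup>+ \<zeta>. ennreal ((cmod (f \<zeta>))\<^sup>2) \<partial>disc_lborel) = ennreal L"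
    unfolding L_def L2_sq_def by (rule nn_integral_eq_integral[OF L2_integrable[OF f]]) simp
  have nF: "(\<integral>\<^sup>+ \<zeta>. ennreal ((cmod (F n \<zeta>))\<^sup>2) \<partial>disc_lborel) \<le> ennreal (L / (r n)\<^sup>2)" for n
    using nn_integral_disc_dilation_le[OF contf r, of n] L0
    unfolding F_def nf by (simp add: ennreal_mult[symmetric])
  have FL: "F n \<in> L2 disc_lborel" for n
  proof -
    have "(\<integral>\<^sup>+ \<zeta>. ennreal (norm ((cmod (F n \<zeta>))\<^sup>2)) \<partial>disc_lborel) < \<infinity>"
      using nF[of n] by (simp add: order_le_less_trans)
    moreover have "(\<lambda>\<zeta>. (cmod (F n \<zeta>))\<^sup>2) \<in> borel_measurable disc_lborel" using mF by measurable
    ultimately show ?thesis using mF by (simp add: L2_def integrableI_bounded)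
  qed
  have FLsq: "L2_sq disc_lborel (F n) \<le> L / (r n)\<^sup>2" for n
  proof -
    have "ennreal (L2_sq disc_lborel (F n)) = (\<integral>\<^sup>+ \<zeta>. ennreal ((cmod (F n \<zeta>))\<^sup>2) \<partial>disc_lborel)"
      unfolding L2_sq_def by (rule nn_integral_eq_integral[symmetric, OF L2_integrable[OF FL]]) simp
    then have "ennreal (L2_sq disc_lborel (F n)) \<le> ennreal (L / (r n)\<^sup>2)" using nF[of n] by simp
    then show ?thesis by (subst (asm) ennreal_le_iff) (use L0 in simp)
  qed
  have ge: "e \<le> L2_sq disc_lborel (\<lambda>\<zeta>. f \<zeta> - F n \<zeta>)" for n
    using contra FL[of n] r[of n] unfolding F_def[abs_def] by force
  define G where "G n \<zeta> = 2 * (cmod (f \<zeta>))\<^sup>2 + 2 * (cmod (F n \<zeta>))\<^sup>2 - (cmod (f \<zeta> - F n \<zeta>))\<^sup>2" for n \<zeta>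
  have G0: "0 \<le> G n \<zeta>" for n \<zeta> using norm_add_square_le[of "f \<zeta>" "- F n \<zeta>"] by (simp add: G_def)
  have iG: "integrable disc_lborel (G n)" for n
    unfolding G_def using L2_integrable[OF f] L2_integrable[OF FL] L2_integrable[OF L2_diff(1)[OF f FL]] by auto
  have IG: "integral\<^sup>L disc_lborel (G n) \<le> 2 * L + 2 * (L / (r n)\<^sup>2) - e" for n
  proof -
    have "integral\<^sup>L disc_lborel (G n) = 2 * L + 2 * L2_sq disc_lborel (F n) - L2_sq disc_lborel (\<lambda>\<zeta>. f \<zeta> - F n \<zeta>)"
      unfolding G_def L_def L2_sq_def
      using L2_integrable[OF f] L2_integrable[OF FL] L2_integrable[OF L2_diff(1)[OF f FL]] by simp
    then show ?thesis using FLsq[of n] ge[of n] by linarith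
  qed
  have lim: "(\<lambda>n. 2 * L + 2 * (L / (r n)\<^sup>2) - e) \<longlonglongrightarrow> 2 * L + 2 * (L / 1\<^sup>2) - e"
    by (intro tendsto_intros rlim) auto
  have nonneg: "0 \<le> 2 * L + 2 * (L / (r n)\<^sup>2) - e" for n
    using IG[of n] Bochner_Integration.integral_nonneg[of "disc_lborel" "G n"] G0 by (meson order_trans)
  then have nonneg': "0 \<le> 2 * L + 2 * (L / 1\<^sup>2) - e"
    by (intro LIMSEQ_le_const[OF lim]) auto
  have "ennreal (4 * L) = (\<integral>\<^sup>+ \<zeta>. ennreal (4 * (cmod (f \<zeta>))\<^sup>2) \<partial>disc_lborel)"
    unfolding L_def L2_sq_def using L2_integrable[OF f]
    by (subst nn_integral_eq_integral) auto
  also have "\<dots> = (\<integral>\<^sup>+ \<zeta>. liminf (\<lambda>n. ennreal (G n \<zeta>)) \<partial>disc_lborel)"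
  proof (rule nn_integral_cong)
    fix \<zeta> assume "\<zeta> \<in> space disc_lborel"
    then have \<zeta>: "\<zeta> \<in> Delta" by (simp add: space_disc_lborel)
    have "(\<lambda>n. 1 + of_real (r n) * (\<zeta> - 1)) \<longlonglongrightarrow> 1 + of_real 1 * (\<zeta> - 1)"
      by (intro tendsto_intros rlim)
    then have "(\<lambda>n. 1 + of_real (r n) * (\<zeta> - 1)) \<longlonglongrightarrow> \<zeta>" by simp
    from continuous_on_tendsto_compose[OF contf this \<zeta>]
    have "(\<lambda>n. F n \<zeta>) \<longlonglongrightarrow> f \<zeta>"
      unfolding F_def using dil[OF \<zeta>] by simp
    then have "(\<lambda>n. G n \<zeta>) \<longlonglongrightarrow> 2 * (cmod (f \<zeta>))\<^sup>2 + 2 * (cmod (f \<zeta>))\<^sup>2 - (cmod (f \<zeta> - f \<zeta>))\<^sup>2"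
      unfolding G_def by (intro tendsto_intros)
    then have "(\<lambda>n. ennreal (G n \<zeta>)) \<longlonglongrightarrow> ennreal (4 * (cmod (f \<zeta>))\<^sup>2)"
      by (intro tendsto_ennrealI) simp
    then show "ennreal (4 * (cmod (f \<zeta>))\<^sup>2) = liminf (\<lambda>n. ennreal (G n \<zeta>))"
      by (intro lim_imp_Liminf[symmetric]) auto
  qed
  also have "\<dots> \<le> liminf (\<lambda>n. \<integral>\<^sup>+ \<zeta>. ennreal (G n \<zeta>) \<partial>disc_lborel)"
    using iG by (intro nn_integral_liminf) (auto intro: borel_measurable_integrable)
  also have "\<dots> \<le> liminf (\<lambda>n. ennreal (2 * L + 2 * (L / (r n)\<^sup>2) - e))"
  proof (intro Liminf_mono always_eventually allI)
    fix n
    have "(\<integral>\<^sup>+ \<zeta>. ennreal (G n \<zeta>) \<partial>disc_lborel) = ennreal (integral\<^sup>L disc_lborel (G n))"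
      using iG G0 by (intro nn_integral_eq_integral) auto
    then show "(\<integral>\<^sup>+ \<zeta>. ennreal (G n \<zeta>) \<partial>disc_lborel) \<le> ennreal (2 * L + 2 * (L / (r n)\<^sup>2) - e)"
      using IG[of n] by (simp add: ennreal_leI)
  qed
  also have "\<dots> = ennreal (2 * L + 2 * (L / 1\<^sup>2) - e)"
    by (intro lim_imp_Liminf tendsto_ennrealI lim) auto
  finally have "4 * L \<le> 2 * L + 2 * (L / 1\<^sup>2) - e" using nonneg' by (simp add: ennreal_le_iff)
  then show False using e by simp
qed

text \<open>
  The Taylor series of the dilated function has radius of convergence at least \<open>1 / r > 1\<close>, so its
  partial sums converge uniformly on the disc.
\<close>

lemma dilation_uniform_polynomial_approx:
  assumes hol: "f holomorphic_on Delta" and r: "0 < r" "r < 1" and \<eta>: "0 < \<eta>"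
  shows "\<exists>p. \<forall>\<zeta>\<in>Delta. cmod (f (1 + of_real r * (\<zeta> - 1)) - poly p \<zeta>) < \<eta>"
proof -
  define a where "a n = (deriv ^^ n) f 1 / fact n" for n
  have ser: "(\<lambda>n. a n * (w - 1) ^ n) sums f w" if "w \<in> Delta" for w
    using holomorphic_power_series[of f 1 1 w] hol that by (simp add: a_def Delta_def)
  define \<rho> where "\<rho> = (1 + r) / 2"
  have \<rho>: "0 < \<rho>" "\<rho> < 1" "r < \<rho>" using r by (auto simp: \<rho>_def)
  have "1 + complex_of_real \<rho> \<in> Delta" using \<rho> by (simp add: Delta_def dist_norm)
  from sums_summable[OF ser[OF this]] have "summable (\<lambda>n. a n * of_real \<rho> ^ n)" by simp
  moreover have "norm (complex_of_real r) < norm (complex_of_real \<rho>)" using r \<rho> by simp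
  ultimately have summ: "summable (\<lambda>n. norm (a n * of_real r ^ n))" by (rule powser_insidea)
  have "uniform_limit Delta (\<lambda>N \<zeta>. \<Sum>n<N. a n * (of_real r * (\<zeta> - 1)) ^ n)
      (\<lambda>\<zeta>. \<Sum>n. a n * (of_real r * (\<zeta> - 1)) ^ n) sequentially"
  proof (rule Weierstrass_m_test[OF _ summ])
    fix n \<zeta> assume "\<zeta> \<in> Delta"
    then have "cmod (\<zeta> - 1) ^ n \<le> 1" by (intro power_le_one) (auto simp: Delta_def dist_norm norm_minus_commute)
    then show "norm (a n * (of_real r * (\<zeta> - 1)) ^ n) \<le> norm (a n * of_real r ^ n)"
      by (simp add: norm_mult norm_power power_mult_distrib mult_left_le mult.assoc[symmetric])
  qed
  then obtain N where N: "\<And>\<zeta>. \<zeta> \<in> Delta \<Longrightarrow>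
      dist (\<Sum>n<N. a n * (of_real r * (\<zeta> - 1)) ^ n) (\<Sum>n. a n * (of_real r * (\<zeta> - 1)) ^ n) < \<eta>"
    using uniform_limitD[OF _ \<eta>] by (force simp: eventually_sequentially)
  define p where "p = (\<Sum>n<N. smult (a n * of_real r ^ n) ([:-1, 1:] ^ n))"
  have "cmod (f (1 + of_real r * (\<zeta> - 1)) - poly p \<zeta>) < \<eta>" if \<zeta>: "\<zeta> \<in> Delta" for \<zeta>
  proof -
    have "cmod (of_real r * (\<zeta> - 1)) \<le> 1 * cmod (\<zeta> - 1)"
      unfolding norm_mult using r by (intro mult_right_mono) auto
    then have "1 + of_real r * (\<zeta> - 1) \<in> Delta" using \<zeta> by (simp add: Delta_def dist_norm norm_minus_commute)
    then have "(\<Sum>n. a n * (of_real r * (\<zeta> - 1)) ^ n) = f (1 + of_real r * (\<zeta> - 1))"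
      using ser[of "1 + of_real r * (\<zeta> - 1)"] by (simp add: sums_iff)
    moreover have "poly p \<zeta> = (\<Sum>n<N. a n * (of_real r * (\<zeta> - 1)) ^ n)"
      by (simp add: p_def poly_sum poly_power power_mult_distrib mult.assoc)
    ultimately show ?thesis using N[OF \<zeta>] by (simp add: dist_norm norm_minus_commute)
  qed
  then show ?thesis by blast
qed

lemma emeasure_disc_lborel: "emeasure disc_lborel (space disc_lborel) = ennreal pi"
  unfolding space_disc_lborel
  by (subst emeasure_restrict_space) (auto simp: Delta_def emeasure_ball unit_ball_vol_2)

lemma bounded_in_L2_disc:
  assumes m: "u \<in> borel_measurable disc_lborel" and b: "\<And>\<zeta>. \<zeta> \<in> Delta \<Longrightarrow> cmod (u \<zeta>) \<le> B"
  shows "u \<in> L2 disc_lborel" "L2_sq disc_lborel u \<le> pi * B\<^sup>2"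
proof -
  interpret finite_measure disc_lborel by standard (simp add: emeasure_disc_lborel)
  have g: "integrable disc_lborel (\<lambda>_. B\<^sup>2)" by simp
  have le: "(cmod (u \<zeta>))\<^sup>2 \<le> B\<^sup>2" if "\<zeta> \<in> space disc_lborel" for \<zeta>
    using b[of \<zeta>] that by (intro power_mono) (auto simp: space_disc_lborel)
  show "u \<in> L2 disc_lborel" by (rule L2_I_le(1)[OF m g le])
  have "measure disc_lborel (space disc_lborel) = pi" by (simp add: measure_def emeasure_disc_lborel)
  then show "L2_sq disc_lborel u \<le> pi * B\<^sup>2" using L2_I_le(2)[OF m g le] by simp
qed

lemma polynomial_in_L2_disc: "poly p \<in> L2 disc_lborel" for p :: "complex poly"
proof -
  have "compact (poly p ` cball 1 1)" by (intro compact_continuous_image continuous_intros) auto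
  then obtain B where "\<And>\<zeta>. \<zeta> \<in> cball 1 1 \<Longrightarrow> cmod (poly p \<zeta>) \<le> B"
    by (meson bounded_iff compact_imp_bounded imageI)
  then show ?thesis
    by (intro bounded_in_L2_disc(1)[of _ B] continuous_on_Delta_measurable continuous_intros) (auto simp: Delta_def)
qed

theorem polynomials_dense_in_bergman:
  assumes hol: "f holomorphic_on Delta" and f: "f \<in> L2 disc_lborel" and e: "0 < e"
  shows "\<exists>p. L2_sq disc_lborel (\<lambda>\<zeta>. f \<zeta> - poly p \<zeta>) < e"
proof -
  have "0 < e / 4" using e by simp
  from L2_disc_dilation_approx[OF hol f this] obtain r where r: "0 < r" "r < 1"
      "(\<lambda>\<zeta>. f (1 + of_real r * (\<zeta> - 1))) \<in> L2 disc_lborel"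
      "L2_sq disc_lborel (\<lambda>\<zeta>. f \<zeta> - f (1 + of_real r * (\<zeta> - 1))) < e / 4"
    by blast
  define \<eta> where "\<eta> = sqrt (e / (4 * pi))"
  have \<eta>: "0 < \<eta>" "pi * \<eta>\<^sup>2 = e / 4" using e by (auto simp: \<eta>_def)
  obtain p where p: "\<And>\<zeta>. \<zeta> \<in> Delta \<Longrightarrow> cmod (f (1 + of_real r * (\<zeta> - 1)) - poly p \<zeta>) < \<eta>"
    using dilation_uniform_polynomial_approx[OF hol r(1,2) \<eta>(1)] by blast
  let ?g = "\<lambda>\<zeta>. f (1 + of_real r * (\<zeta> - 1))"
  have gp: "(\<lambda>\<zeta>. ?g \<zeta> - poly p \<zeta>) \<in> L2 disc_lborel" by (rule L2_diff(1)[OF r(3) polynomial_in_L2_disc])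
  have "L2_sq disc_lborel (\<lambda>\<zeta>. ?g \<zeta> - poly p \<zeta>) \<le> pi * \<eta>\<^sup>2"
    using p by (intro bounded_in_L2_disc(2) L2_measurable[OF gp]) (auto intro: less_imp_le)
  then have "L2_sq disc_lborel (\<lambda>\<zeta>. f \<zeta> - ?g \<zeta> + (?g \<zeta> - poly p \<zeta>)) < e"
    using L2_add(2)[OF L2_diff(1)[OF f r(3)] gp] r(4) \<eta>(2) by linarith
  then show ?thesis by auto
qed

section \<open>Completeness of the powers\<close>

text \<open>
  With \<open>\<alpha> = \<pi>/2 - |arg v|\<close> this is the inequality \<open>\<alpha> cos \<alpha> \<le> sin \<alpha>\<close>.
\<close>

lemma Im_mult_Im_Ln_ge:
  assumes "0 < Re v"
  shows "pi / 2 * \<bar>Im v\<bar> - Re v \<le> Im v * Im (Ln v)"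
proof -
  have v0: "v \<noteq> 0" using assms by auto
  define \<theta> where "\<theta> = Im (Ln v)"
  define \<alpha> where "\<alpha> = pi / 2 - \<bar>\<theta>\<bar>"
  have \<theta>: "\<bar>\<theta>\<bar> < pi / 2" using Re_Ln_pos_lt[OF v0] assms by (simp add: \<theta>_def)
  have R: "0 < cmod v" using v0 by simp
  have re: "Re v = cmod v * cos \<theta>" and im: "Im v = cmod v * sin \<theta>"
    using Re_exp[of "Ln v"] Im_exp[of "Ln v"] v0 by (simp_all add: \<theta>_def)
  have s: "sin \<theta> * \<theta> = cos \<alpha> * \<bar>\<theta>\<bar>" "\<bar>sin \<theta>\<bar> = cos \<alpha>" "cos \<theta> = sin \<alpha>"
  proof -
    have "cos \<alpha> = sin \<bar>\<theta>\<bar>" "sin \<alpha> = cos \<bar>\<theta>\<bar>" by (auto simp: \<alpha>_def cos_diff sin_diff)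
    moreover have "0 \<le> sin \<bar>\<theta>\<bar>" using \<theta> by (intro sin_ge_zero) auto
    ultimately show "sin \<theta> * \<theta> = cos \<alpha> * \<bar>\<theta>\<bar>" "\<bar>sin \<theta>\<bar> = cos \<alpha>" "cos \<theta> = sin \<alpha>"
      by (auto simp: abs_if split: if_splits)
  qed
  have "\<alpha> * cos \<alpha> \<le> sin \<alpha>"
  proof (cases "\<theta> = 0")
    case True
    then show ?thesis by (simp add: \<alpha>_def)
  next
    case False
    then have a: "0 < \<alpha>" "\<alpha> < pi / 2" using \<theta> by (auto simp: \<alpha>_def)
    then have c: "0 < cos \<alpha>" by (intro cos_gt_zero) auto
    have "0 < tan \<alpha>" using a by (intro tan_gt_zero) auto
    then have "\<alpha> \<le> tan \<alpha>" using abs_tan_ge[of \<alpha>] a by simp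
    then show ?thesis using c by (simp add: tan_def field_simps)
  qed
  then have "cmod v * (\<alpha> * cos \<alpha>) \<le> cmod v * sin \<alpha>" using R by (intro mult_left_mono) auto
  then have "pi / 2 * (cmod v * cos \<alpha>) - cmod v * sin \<alpha> \<le> cmod v * (cos \<alpha> * \<bar>\<theta>\<bar>)"
    by (simp add: \<alpha>_def algebra_simps)
  moreover have "\<bar>Im v\<bar> = cmod v * cos \<alpha>" using s(2) by (simp add: im abs_mult)
  moreover have "Im v * Im (Ln v) = cmod v * (cos \<alpha> * \<bar>\<theta>\<bar>)"
    using s(1) unfolding im by (simp add: \<theta>_def[symmetric] mult.assoc)
  moreover have "Re v = cmod v * sin \<alpha>" using re s(3) by simp
  ultimately show ?thesis by simp
qed

lemma exp_mult_Ln_norm_le: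
  assumes "0 \<le> Re w"
  shows "cmod (exp (w * Ln (1 + w))) \<le> exp (Re w * ln (1 + cmod w) - pi / 2 * \<bar>Im w\<bar> + (1 + Re w))"
proof -
  have v: "0 < Re (1 + w)" using assms by simp
  then have nz: "1 + w \<noteq> 0" by (metis less_irrefl zero_complex.sel(1))
  have "ln (cmod (1 + w)) \<le> ln (1 + cmod w)"
    using norm_triangle_ineq[of 1 w] nz by (subst ln_le_cancel_iff) (auto intro: add_pos_nonneg)
  then have "Re w * ln (cmod (1 + w)) \<le> Re w * ln (1 + cmod w)" using assms by (intro mult_left_mono) auto
  moreover have "pi / 2 * \<bar>Im w\<bar> - (1 + Re w) \<le> Im w * Im (Ln (1 + w))"
    using Im_mult_Im_Ln_ge[OF v] by simp
  moreover have "Re (w * Ln (1 + w)) = Re w * ln (cmod (1 + w)) - Im w * Im (Ln (1 + w))"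
    using nz by simp
  ultimately show ?thesis unfolding norm_exp_eq_Re exp_le_cancel_iff by linarith
qed

text \<open>
  The transforms of the \<open>h n\<close> converge locally uniformly by the Cauchy-Schwarz inequality, so their
  limit \<open>F\<close> is holomorphic, with zeros at the \<open>z j\<close>. Its growth \<open>e\<^sup>\<pi>\<^sup>|\<^sup>y\<^sup>|\<^sup>/\<^sup>2 2\<^sup>x\<close> is of
  a different shape than the one in the uniqueness principle; the zero-free factor
  \<open>exp (w log (1 + w))\<close> exchanges \<open>e\<^sup>\<pi>\<^sup>|\<^sup>y\<^sup>|\<^sup>/\<^sup>2\<close> for \<open>exp (x log (1 + |w|))\<close>.
\<close>

lemma powr_transform_limit_vanishes:
  fixes z :: "nat \<Rightarrow> complex" and h :: "nat \<Rightarrow> complex \<Rightarrow> complex"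
  assumes z: "inj z" "0 < \<epsilon>" "\<And>j. \<epsilon> \<le> Re (z j)"
    and density: "Limsup at_top (\<lambda>R::real.
           (\<Sum>\<^sub>\<infinity>j\<in>{j. cmod (z j) \<le> R}. ennreal (Re (1 / z j))) / ennreal (ln R))
         > ennreal (2 / pi)"
    and h: "\<And>n. h n \<in> L2 disc_lborel"
    and Cauchy: "\<And>e. 0 < e \<Longrightarrow> \<exists>N. \<forall>m\<ge>N. \<forall>n\<ge>N. L2_sq disc_lborel (\<lambda>x. h m x - h n x) < e"
    and zeros: "\<And>j. (\<lambda>n. L2_inner disc_lborel (\<lambda>\<zeta>. \<zeta> powr (z j - 1)) (h n)) \<longlonglongrightarrow> 0"
    and w: "0 < Re w"
  shows "(\<lambda>n. L2_inner disc_lborel (\<lambda>\<zeta>. \<zeta> powr (w - 1)) (h n)) \<longlonglongrightarrow> 0"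
proof -
  define \<Phi> where "\<Phi> n w = L2_inner disc_lborel (\<lambda>\<zeta>. \<zeta> powr (w - 1)) (h n)" for n w
  have kL: "(\<lambda>\<zeta>. \<zeta> powr (w - 1)) \<in> L2 disc_lborel" if "0 < Re w" for w
    using powr_in_L2_disc[OF that] by auto
  have diffb: "(cmod (\<Phi> m w - \<Phi> n w))\<^sup>2
      \<le> L2_sq disc_lborel (\<lambda>\<zeta>. \<zeta> powr (w - 1)) * L2_sq disc_lborel (\<lambda>x. h m x - h n x)"
    if "0 < Re w" for w m n
    using L2_Cauchy_Schwarz[OF kL[OF that] L2_diff(1)[OF h h]]
    unfolding \<Phi>_def L2_inner_diff_right[OF h h kL[OF that]] .
  have ucauchy: "uniformly_Cauchy_on X \<Phi>"
    if X: "\<And>w. w \<in> X \<Longrightarrow> 0 < Re w" and B: "\<And>w. w \<in> X \<Longrightarrow> L2_sq disc_lborel (\<lambda>\<zeta>. \<zeta> powr (w - 1)) \<le> B" for X B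
  proof (unfold uniformly_Cauchy_on_def, intro allI impI)
    fix e :: real assume e: "0 < e"
    have B1: "0 < \<bar>B\<bar> + 1" by simp
    have "0 < e\<^sup>2 / (\<bar>B\<bar> + 1)" using e by simp
    from Cauchy[OF this] obtain N where
      N: "\<And>m n. N \<le> m \<Longrightarrow> N \<le> n \<Longrightarrow> L2_sq disc_lborel (\<lambda>x. h m x - h n x) < e\<^sup>2 / (\<bar>B\<bar> + 1)"
      by blast
    have "dist (\<Phi> m w) (\<Phi> n w) < e" if w: "w \<in> X" and mn: "m \<ge> N" "n \<ge> N" for w m n
    proof -
      have "(cmod (\<Phi> m w - \<Phi> n w))\<^sup>2 \<le> (\<bar>B\<bar> + 1) * L2_sq disc_lborel (\<lambda>x. h m x - h n x)"
        using diffb[OF X[OF w], of m n] B[OF w] mult_right_mono[of _ "\<bar>B\<bar> + 1"] L2_sq_nonneg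
        by (smt (verit))
      also have "\<dots> < (\<bar>B\<bar> + 1) * (e\<^sup>2 / (\<bar>B\<bar> + 1))" by (intro mult_strict_left_mono N mn B1)
      also have "\<dots> = e\<^sup>2" using B1 by simp
      finally show ?thesis unfolding dist_norm by (rule power2_less_imp_less) (use e in simp)
    qed
    then show "\<exists>M. \<forall>x\<in>X. \<forall>m\<ge>M. \<forall>n\<ge>M. dist (\<Phi> m x) (\<Phi> n x) < e" by blast
  qed
  define F where "F w = lim (\<lambda>n. \<Phi> n w)" for w
  have Flim: "(\<lambda>n. \<Phi> n w) \<longlonglongrightarrow> F w" if "0 < Re w" for w
  proof -
    have "uniformly_Cauchy_on {w} \<Phi>" using that by (intro ucauchy[of _ "L2_sq disc_lborel (\<lambda>\<zeta>. \<zeta> powr (w - 1))"]) auto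
    then have "uniformly_convergent_on {w} \<Phi>" by (rule Cauchy_uniformly_convergent)
    then have "convergent (\<lambda>n. \<Phi> n w)" by (rule uniformly_convergent_imp_convergent) simp
    then show ?thesis unfolding F_def by (simp add: convergent_LIMSEQ_iff)
  qed
  have holF: "F holomorphic_on right_half_plane"
  proof (rule holomorphic_uniform_sequence[OF open_right_half_plane])
    show "\<Phi> n holomorphic_on right_half_plane" for n
      unfolding \<Phi>_def using h by (rule holomorphic_powr_transform)
    fix w0 assume "w0 \<in> right_half_plane"
    then have w0: "0 < Re w0" by (simp add: right_half_plane_def)
    define d where "d = Re w0 / 2"
    have d: "0 < d" using w0 by (simp add: d_def)
    have near: "d \<le> Re w \<and> Re w \<le> Re w0 + d \<and> \<bar>Im w\<bar> \<le> \<bar>Im w0\<bar> + d" if "w \<in> cball w0 d" for w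
    proof -
      have "\<bar>Re w0 - Re w\<bar> \<le> d" "\<bar>Im w0 - Im w\<bar> \<le> d"
        using that abs_Re_le_cmod[of "w0 - w"] abs_Im_le_cmod[of "w0 - w"] by (auto simp: dist_norm)
      then show ?thesis unfolding d_def by linarith
    qed
    obtain A where A: "0 \<le> A" "\<And>w. d \<le> Re w \<Longrightarrow>
        L2_sq disc_lborel (\<lambda>\<zeta>. \<zeta> powr (w - 1)) \<le> A * exp (pi * \<bar>Im w\<bar>) * 4 powr Re w"
      using powr_in_L2_disc[OF d] by blast
    have "uniformly_Cauchy_on (cball w0 d) \<Phi>"
    proof (rule ucauchy)
      fix w assume "w \<in> cball w0 d"
      note n = near[OF this]
      then show "0 < Re w" using d by linarith
      have "A * exp (pi * \<bar>Im w\<bar>) * 4 powr Re w \<le> A * exp (pi * (\<bar>Im w0\<bar> + d)) * 4 powr (Re w0 + d)"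
        using n A(1) by (intro mult_mono powr_mono) auto
      then show "L2_sq disc_lborel (\<lambda>\<zeta>. \<zeta> powr (w - 1)) \<le> A * exp (pi * (\<bar>Im w0\<bar> + d)) * 4 powr (Re w0 + d)"
        using A(2)[of w] n by linarith
    qed
    then have "uniformly_convergent_on (cball w0 d) \<Phi>" by (rule Cauchy_uniformly_convergent)
    then obtain l where l: "uniform_limit (cball w0 d) \<Phi> l sequentially"
      by (auto simp: uniformly_convergent_on_def)
    have lF: "l w = F w" if "w \<in> cball w0 d" for w
      using LIMSEQ_unique[OF tendsto_uniform_limitI[OF l that] Flim] near[OF that] d by auto
    have "uniform_limit (cball w0 d) \<Phi> F sequentially"
      using l lF unfolding uniform_limit_iff by simp
    moreover have "cball w0 d \<subseteq> right_half_plane" using near d by (force simp: right_half_plane_def)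
    ultimately show "\<exists>d>0. cball w0 d \<subseteq> right_half_plane \<and> uniform_limit (cball w0 d) \<Phi> F sequentially"
      using d by blast
  qed
  obtain N where N: "\<And>n. N \<le> n \<Longrightarrow> L2_sq disc_lborel (\<lambda>x. h n x - h N x) < 1"
    using Cauchy[of 1] by auto
  define H where "H = 2 * L2_sq disc_lborel (h N) + 2"
  have H0: "0 \<le> H" using L2_sq_nonneg[of disc_lborel "h N"] by (simp add: H_def)
  have H: "L2_sq disc_lborel (h n) \<le> H" if "N \<le> n" for n
    using L2_add(2)[OF L2_diff(1)[OF h h] h, of n N N] N[OF that] by (simp add: H_def)
  have Fb: "(cmod (F w))\<^sup>2 \<le> L2_sq disc_lborel (\<lambda>\<zeta>. \<zeta> powr (w - 1)) * H" if w: "0 < Re w" for w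
  proof (rule tendsto_upperbound)
    show "(\<lambda>n. (cmod (\<Phi> n w))\<^sup>2) \<longlonglongrightarrow> (cmod (F w))\<^sup>2" by (intro tendsto_intros Flim w)
    show "\<forall>\<^sub>F n in sequentially. (cmod (\<Phi> n w))\<^sup>2 \<le> L2_sq disc_lborel (\<lambda>\<zeta>. \<zeta> powr (w - 1)) * H"
      using eventually_ge_at_top[of N]
    proof eventually_elim
      case (elim n)
      then show ?case
        using L2_Cauchy_Schwarz[OF kL[OF w] h, of n] mult_left_mono[OF H L2_sq_nonneg] unfolding \<Phi>_def
        by (meson order_trans)
    qed
  qed simp
  define G where "G w = F w * exp (w * Ln (1 + w))" for w
  have "G w = 0"
  proof (rule vanishes_if_zeros_dense[where F = G, OF _ _ _ z density])
    show "G holomorphic_on right_half_plane" unfolding G_def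
      by (intro holomorphic_intros holF) (auto simp: right_half_plane_def complex_nonpos_Reals_iff)
    show "G (z j) = 0" for j
    proof -
      have "0 < Re (z j)" using z(2) z(3)[of j] by linarith
      then have "F (z j) = 0" using LIMSEQ_unique[OF Flim zeros[of j, folded \<Phi>_def]] by blast
      then show ?thesis by (simp add: G_def)
    qed
    show "w \<in> right_half_plane" using w by (simp add: right_half_plane_def)
    fix \<delta> :: real assume \<delta>: "0 < \<delta>"
    obtain A where A: "0 \<le> A" "\<And>w. \<delta> \<le> Re w \<Longrightarrow>
        L2_sq disc_lborel (\<lambda>\<zeta>. \<zeta> powr (w - 1)) \<le> A * exp (pi * \<bar>Im w\<bar>) * 4 powr Re w"
      using powr_in_L2_disc[OF \<delta>] by blast
    define D where "D = sqrt (A * H) + 1"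
    have D: "1 \<le> D" "A * H \<le> D\<^sup>2"
      using A(1) H0 by (auto simp: D_def power2_sum)
    show "\<exists>C. \<forall>w. \<delta> \<le> Re w \<longrightarrow> cmod (G w) \<le> exp (C * (1 + Re w) + Re w * ln (1 + cmod w))"
    proof (intro exI[of _ "ln D + ln 2 + 1"] allI impI)
      fix w assume w: "\<delta> \<le> Re w"
      have x: "0 < Re w" using w \<delta> by linarith
      have "(cmod (F w))\<^sup>2 \<le> A * exp (pi * \<bar>Im w\<bar>) * 4 powr Re w * H"
        using Fb[OF x] mult_right_mono[OF A(2)[OF w] H0] by linarith
      also have "\<dots> = A * H * (exp (pi * \<bar>Im w\<bar>) * 4 powr Re w)" by simp
      also have "\<dots> \<le> D\<^sup>2 * (exp (pi * \<bar>Im w\<bar>) * 4 powr Re w)"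
        using D by (intro mult_right_mono) auto
      also have "\<dots> = (exp (ln D + pi / 2 * \<bar>Im w\<bar> + Re w * ln 2))\<^sup>2"
      proof -
        have "4 powr Re w = exp (2 * (Re w * ln 2))"
          using ln_realpow[of 2 2] by (simp add: powr_def)
        moreover have "D\<^sup>2 = exp (2 * ln D)" using D by (simp add: exp_double)
        ultimately show ?thesis
          unfolding exp_double[symmetric] by (simp add: exp_add[symmetric] algebra_simps)
      qed
      finally have F: "cmod (F w) \<le> exp (ln D + pi / 2 * \<bar>Im w\<bar> + Re w * ln 2)"
        by (rule power2_le_imp_le) simp
      have "cmod (G w) \<le> exp (ln D + pi / 2 * \<bar>Im w\<bar> + Re w * ln 2)
          * exp (Re w * ln (1 + cmod w) - pi / 2 * \<bar>Im w\<bar> + (1 + Re w))"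
        unfolding G_def norm_mult using F exp_mult_Ln_norm_le[of w] x by (intro mult_mono) auto
      also have "\<dots> = exp (ln D + Re w * ln 2 + Re w * ln (1 + cmod w) + 1 + Re w)"
        unfolding exp_add[symmetric] by simp
      also have "\<dots> \<le> exp ((ln D + ln 2 + 1) * (1 + Re w) + Re w * ln (1 + cmod w))"
      proof (subst exp_le_cancel_iff)
        have "0 \<le> ln D * Re w" "0 \<le> ln (2::real)" using D x by auto
        moreover have "(ln D + ln 2 + 1) * (1 + Re w) = ln D + ln D * Re w + ln 2 + Re w * ln 2 + 1 + Re w"
          by (simp only: distrib_left distrib_right) simp
        ultimately show "ln D + Re w * ln 2 + Re w * ln (1 + cmod w) + 1 + Re w
            \<le> (ln D + ln 2 + 1) * (1 + Re w) + Re w * ln (1 + cmod w)"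
          by linarith
      qed
      finally show "cmod (G w) \<le> exp ((ln D + ln 2 + 1) * (1 + Re w) + Re w * ln (1 + cmod w))" .
    qed
  qed
  then have "F w = 0" by (simp add: G_def)
  then show ?thesis using Flim[OF w] by (simp add: \<Phi>_def)
qed

lemma bergman2_iff_L2_disc: "f \<in> bergman2 \<longleftrightarrow> f holomorphic_on Delta \<and> f \<in> L2 disc_lborel"
proof -
  have "set_integrable lborel Delta (\<lambda>z. (cmod (f z))\<^sup>2) \<longleftrightarrow> integrable disc_lborel (\<lambda>z. (cmod (f z))\<^sup>2)"
    by (simp add: set_integrable_def integrable_restrict_space[OF sets_Delta_lborel])
  then show ?thesis
    by (auto simp: bergman2_def L2_def intro: continuous_on_Delta_measurable holomorphic_on_imp_continuous_on)
qed

lemma bergman_norm_eq_L2_sq: "bergman_norm f = sqrt (L2_sq disc_lborel f)"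
  by (simp add: bergman_norm_def L2_sq_def set_lebesgue_integral_def integral_restrict_space[OF sets_Delta_lborel])

lemma powr_in_bergman2:
  assumes "0 < Re w"
  shows "(\<lambda>\<zeta>. \<zeta> powr (w - 1)) \<in> bergman2"
  unfolding bergman2_iff_L2_disc
proof
  show "(\<lambda>\<zeta>. \<zeta> powr (w - 1)) holomorphic_on Delta"
    by (intro holomorphic_intros) (use Delta_props in auto)
  show "(\<lambda>\<zeta>. \<zeta> powr (w - 1)) \<in> L2 disc_lborel" using powr_in_L2_disc[OF assms] by auto
qed

text \<open>
  The monomial \<open>\<zeta>\<^sup>k\<close> is the power with exponent \<open>w - 1\<close> for \<open>w = k + 1\<close>, a point of the
  right half plane.
\<close>

lemma L2_inner_polynomial_tendsto_0:
  assumes h: "\<And>n. h n \<in> L2 disc_lborel"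
    and lim: "\<And>w. 0 < Re w \<Longrightarrow> (\<lambda>n. L2_inner disc_lborel (\<lambda>\<zeta>. \<zeta> powr (w - 1)) (h n)) \<longlonglongrightarrow> 0"
  shows "(\<lambda>n. L2_inner disc_lborel (poly p) (h n)) \<longlonglongrightarrow> 0"
proof -
  have kL: "(\<lambda>\<zeta>. \<zeta> powr (of_nat (Suc k) - 1)) \<in> L2 disc_lborel" for k
    using powr_in_L2_disc[of "real (Suc k)"] by (auto simp del: of_nat_Suc)
  have "L2_inner disc_lborel (poly p) (h n)
      = (\<Sum>k\<le>degree p. coeff p k * L2_inner disc_lborel (\<lambda>\<zeta>. \<zeta> powr (of_nat (Suc k) - 1)) (h n))" for n
  proof -
    have "L2_inner disc_lborel (poly p) (h n)
        = (\<integral>\<zeta>. (\<Sum>k\<le>degree p. coeff p k * (\<zeta> powr (of_nat (Suc k) - 1) * cnj (h n \<zeta>))) \<partial>disc_lborel)"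
      unfolding L2_inner_def
    proof (rule Bochner_Integration.integral_cong[OF refl])
      fix \<zeta> assume "\<zeta> \<in> space disc_lborel"
      then have "\<zeta> \<noteq> 0" by (simp add: space_disc_lborel Delta_props)
      then have "\<zeta> powr (of_nat (Suc k) - 1) = \<zeta> ^ k" for k by (simp add: powr_nat')
      then show "poly p \<zeta> * cnj (h n \<zeta>)
          = (\<Sum>k\<le>degree p. coeff p k * (\<zeta> powr (of_nat (Suc k) - 1) * cnj (h n \<zeta>)))"
        by (simp add: poly_altdef sum_distrib_right mult.assoc)
    qed
    also have "\<dots> = (\<Sum>k\<le>degree p. \<integral>\<zeta>. coeff p k * (\<zeta> powr (of_nat (Suc k) - 1) * cnj (h n \<zeta>)) \<partial>disc_lborel)"
      by (intro Bochner_Integration.integral_sum integrable_mult_right L2_inner_integrable kL h)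
    finally show ?thesis unfolding L2_inner_def by (simp only: integral_mult_right_zero)
  qed
  moreover have "(\<lambda>n. \<Sum>k\<le>degree p. coeff p k * L2_inner disc_lborel (\<lambda>\<zeta>. \<zeta> powr (of_nat (Suc k) - 1)) (h n)) \<longlonglongrightarrow> 0"
    by (intro tendsto_null_sum tendsto_mult_right_zero lim) simp
  ultimately show ?thesis by (simp only:)
qed

theorem powers_complete_in_bergman2:
  fixes z :: "nat \<Rightarrow> complex"
  assumes z: "inj z" "0 < \<epsilon>" "\<And>j. \<epsilon> \<le> Re (z j)"
    and density: "Limsup at_top (\<lambda>R::real.
           (\<Sum>\<^sub>\<infinity>j\<in>{j. cmod (z j) \<le> R}. ennreal (Re (1 / z j))) / ennreal (ln R))
         > ennreal (2 / pi)"
  shows "complete_in_bergman2 (range (\<lambda>j. \<lambda>\<zeta>. \<zeta> powr (z j - 1)))"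
  unfolding complete_in_bergman2_def
proof (intro conjI ballI allI impI)
  let ?S = "range (\<lambda>j. \<lambda>\<zeta>. \<zeta> powr (z j - 1))"
  have zp: "0 < Re (z j)" for j using z(2) z(3)[of j] by linarith
  show SB: "?S \<subseteq> bergman2" using powr_in_bergman2[OF zp] by auto
  have span_add: "(\<lambda>x. u x + v x) \<in> complex_fun.span ?S"
    if "u \<in> complex_fun.span ?S" "v \<in> complex_fun.span ?S" for u v
    using complex_fun.span_add[OF that] by (simp add: plus_fun_def)
  have span_L2: "u \<in> L2 disc_lborel" if "u \<in> complex_fun.span ?S" for u
    using that
  proof (induction rule: complex_fun.span_induct_alt)
    case base
    then show ?case by (simp add: L2_def zero_fun_def)
  next
    case (step c x y)
    then have "x \<in> L2 disc_lborel" using SB by (auto simp: bergman2_iff_L2_disc)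
    then show ?case using L2_add(1)[OF L2_scale(1) step(2)] by (simp add: plus_fun_def)
  qed
  fix f and e :: real assume f: "f \<in> bergman2" and e: "0 < e"
  have fL: "f holomorphic_on Delta" "f \<in> L2 disc_lborel" using f by (auto simp: bergman2_iff_L2_disc)
  have "\<exists>g\<in>complex_fun.span ?S. L2_sq disc_lborel (\<lambda>x. f x - g x) < e\<^sup>2"
  proof (rule L2_dense_if_weakly_orthogonal_vanish[where Q = "range poly"])
    show "complex_fun.span ?S \<subseteq> L2 disc_lborel" using span_L2 by blast
    show "complex_fun.span ?S \<noteq> {}" using complex_fun.span_zero by blast
    show "(\<lambda>x. c * u x) \<in> complex_fun.span ?S" if "u \<in> complex_fun.span ?S" for c u
      using that by (rule complex_fun.span_scale)
    show "range poly \<subseteq> L2 disc_lborel" using polynomial_in_L2_disc by blast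
    show "\<exists>p\<in>range poly. L2_sq disc_lborel (\<lambda>x. f x - p x) < e" if "0 < e" for e
      using polynomials_dense_in_bergman[OF fL that] by blast
  next
    fix h :: "nat \<Rightarrow> complex \<Rightarrow> complex" and p :: "complex \<Rightarrow> complex"
    assume h: "\<And>n. h n \<in> L2 disc_lborel"
      and Cauchy: "\<And>e. 0 < e \<Longrightarrow> \<exists>N. \<forall>m\<ge>N. \<forall>n\<ge>N. L2_sq disc_lborel (\<lambda>x. h m x - h n x) < e"
      and zero: "\<And>s. s \<in> complex_fun.span ?S \<Longrightarrow> (\<lambda>n. L2_inner disc_lborel s (h n)) \<longlonglongrightarrow> 0"
      and p: "p \<in> range poly"
    have lim: "(\<lambda>n. L2_inner disc_lborel (\<lambda>\<zeta>. \<zeta> powr (w - 1)) (h n)) \<longlonglongrightarrow> 0" if "0 < Re w" for w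
      by (rule powr_transform_limit_vanishes[OF z density h Cauchy zero[OF complex_fun.span_base] that]) auto
    obtain q where "p = poly q" using p by blast
    then show "(\<lambda>n. L2_inner disc_lborel p (h n)) \<longlonglongrightarrow> 0"
      using L2_inner_polynomial_tendsto_0[of h q, OF h lim] by simp
  qed (use span_add fL e in auto)
  then obtain g where g: "g \<in> complex_fun.span ?S" "L2_sq disc_lborel (\<lambda>x. f x - g x) < e\<^sup>2" by blast
  have "bergman_norm (\<lambda>z. f z - g z) < e"
    unfolding bergman_norm_eq_L2_sq using g(2) e real_sqrt_less_mono[OF g(2)] by simp
  then show "\<exists>g\<in>complex_fun.span ?S. bergman_norm (\<lambda>z. f z - g z) < e" using g(1) by blast
qed

theorem theorem7:
  fixes z :: "nat \<Rightarrow> complex" and \<epsilon>0 :: real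
  assumes "inj z"
    and "range z \<subseteq> right_half_plane"
    and "0 < \<epsilon>0"
    and "\<And>j. \<epsilon>0 \<le> Re (z j)"
    and "Limsup at_top (\<lambda>R::real.
           (\<Sum>\<^sub>\<infinity>j\<in>{j. cmod (z j) \<le> R}. ennreal (Re (1 / z j))) / ennreal (ln R))
         > ennreal (2 / pi)"
  shows "uniqueness_set_M2_omega (range z) \<and>
         complete_in_bergman2 (range (\<lambda>j. \<lambda>\<zeta>. \<zeta> powr (z j - 1)))"
proof
  show "uniqueness_set_M2_omega (range z)"
    unfolding uniqueness_set_M2_omega_def
  proof (intro conjI ballI impI)
    show "range z \<subseteq> right_half_plane" by (rule assms(2))
    fix f w assume f: "f \<in> M2_omega" "\<forall>w\<in>range z. f w = 0" and w: "w \<in> right_half_plane"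
    show "f w = 0"
    proof (rule vanishes_if_zeros_dense[where F = f, OF _ M2_omega_growth[OF f(1)] _ assms(1,3,4,5) w])
      show "f holomorphic_on right_half_plane" using f(1) by (simp add: M2_omega_def)
      show "f (z j) = 0" for j using f(2) by simp
    qed
  qed
  show "complete_in_bergman2 (range (\<lambda>j. \<lambda>\<zeta>. \<zeta> powr (z j - 1)))"
    by (rule powers_complete_in_bergman2[OF assms(1,3,4,5)])
qed

end
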